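(* Let $n \geq 1$. Every rational inner function on $\mathbb{D}^n$ belongs to $\mathcal{D}_{1/n}(\mathbb{D}^n) = \mathcal{D}_{1/n, \ldots, 1/n}(\mathbb{D}^n)$.
   Context: $\mathbb{D}^n = \{z \in \mathbb{C}^n : |z_j| < 1,\ j = 1,\ldots,n\}$ is the unit polydisc and $\mathbb{T}^n$ is the $n$-torus. A rational inner function (RIF) on $\mathbb{D}^n$ is a bounded holomorphic function $\phi : \mathbb{D}^n \to \mathbb{C}$ that is a quotient of two polynomials in $\mathbb{C}[z_1,\ldots,z_n]$ and satisfies $|\phi(z)| = 1$ for almost every $z \in \mathbb{T}^n$ (boundary values). For a scalar $\alpha \in \mathbb{R}$, $\mathcal{D}_\alpha(\mathbb{D}^n) = \mathcal{D}_{\alpha,\ldots,\alpha}(\mathbb{D}^n)$ is the set of holomorphic $f(z) = \sum_{k \in \mathbb{N}^n} \hat f(k) z^k$ on $\mathbb{D}^n$ (with $0\in\mathbb{N}$) such that $\sum_{k \in \mathbb{N}^n} (1+k_1)^{\alpha}\cdots(1+k_n)^{\alpha} |\hat f(k)|^2 < \infty$. *)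

theory Defs
  imports "HOL-Analysis.Analysis" "HOL-Library.Poly_Mapping"
begin

definition polydisc :: "(complex ^ 'n) set" where
  "polydisc = {z. \<forall>j. cmod (z $ j) < 1}"

text \<open>Multi-indices are vectors \<open>k :: nat ^ 'n\<close>.\<close>

definition multi_power :: "complex ^ 'n \<Rightarrow> nat ^ 'n \<Rightarrow> complex" where
  "multi_power z k = (\<Prod>j\<in>UNIV. z $ j ^ (k $ j))"

text \<open>The polynomial ring in the variables indexed by \<open>'n\<close> is the monoid algebra
  \<open>(nat ^ 'n) \<Rightarrow>\<^sub>0 complex\<close>.\<close>

definition mpoly_eval :: "((nat ^ 'n) \<Rightarrow>\<^sub>0 complex) \<Rightarrow> complex ^ 'n \<Rightarrow> complex" where
  "mpoly_eval p z = (\<Sum>k\<in>Poly_Mapping.keys p. Poly_Mapping.lookup p k * multi_power z k)"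

text \<open>Holomorphy in several variables: the real Frechet derivative exists and is complex linear
  (additivity is part of \<open>has_derivative\<close>).\<close>

definition multi_holomorphic_on :: "(complex ^ 'n \<Rightarrow> complex) \<Rightarrow> (complex ^ 'n) set \<Rightarrow> bool" where
  "multi_holomorphic_on f S \<longleftrightarrow>
     (\<forall>z\<in>S. \<exists>D. (f has_derivative D) (at z within S) \<and> (\<forall>c v. D (c *s v) = c * D v))"

text \<open>Normalised Haar measure of the \<open>n\<close>-torus, as a Borel measure on the ambient space
  concentrated on the torus.\<close>

definition torus_measure :: "(complex ^ 'n) measure" where
  "torus_measure =
     distr (uniform_measure lborel (cbox 0 (\<chi> j. 2 * pi) :: (real ^ 'n) set)) borel
       (\<lambda>t. \<chi> j. cis (t $ j))"

text \<open>The denominator is only required to be a nonzero polynomial; it is not assumed to be free of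
  zeros in the polydisc. Boundary values are radial limits.\<close>

definition rational_inner :: "(complex ^ 'n \<Rightarrow> complex) \<Rightarrow> bool" where
  "rational_inner \<phi> \<longleftrightarrow>
     multi_holomorphic_on \<phi> polydisc \<and>
     bounded (\<phi> ` polydisc) \<and>
     (\<exists>p q. q \<noteq> 0 \<and>
        (\<forall>z\<in>polydisc. mpoly_eval q z \<noteq> 0 \<longrightarrow> \<phi> z = mpoly_eval p z / mpoly_eval q z)) \<and>
     (AE \<zeta> in torus_measure.
        \<exists>w. ((\<lambda>r. \<phi> (r *\<^sub>R \<zeta>)) \<longlongrightarrow> w) (at_left 1) \<and> cmod w = 1)"

text \<open>The coefficient family \<open>c\<close> is the (unique) family of Taylor coefficients of \<open>f\<close> at the
  origin. The values of \<open>f\<close> outside the polydisc play no role.\<close>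

definition dirichlet_space :: "real ^ 'n \<Rightarrow> (complex ^ 'n \<Rightarrow> complex) set" where
  "dirichlet_space \<alpha> =
     {f. multi_holomorphic_on f polydisc \<and>
         (\<exists>c. (\<forall>z\<in>polydisc. ((\<lambda>k. c k * multi_power z k) has_sum f z) UNIV) \<and>
              (\<lambda>k. (\<Prod>j\<in>UNIV. (1 + real (k $ j)) powr (\<alpha> $ j)) * (cmod (c k))\<^sup>2)
                summable_on UNIV)}"

end

theory Submission
  imports Defs "HOL-Complex_Analysis.Complex_Analysis"
begin

text \<open>Let \<open>\<phi>\<close> be a quotient of polynomials that is holomorphic and bounded by \<open>M\<close> on the polydisc,
  with Taylor coefficients \<open>c k\<close>. For fixed \<open>j\<close> and \<open>z\<close> the slice \<open>u \<mapsto> \<phi> (z\<^sub>1, \<dots>, u z\<^sub>j, \<dots>, z\<^sub>n)\<close> is a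
  rational function of one variable of some degree at most \<open>m\<close>, independent of \<open>z\<close>. If \<open>a\<close> are its Taylor
  coefficients, the Hankel matrix \<open>a (i + j + 1)\<close> has rank at most \<open>m\<close> and norm at most \<open>M\<close>, so its squared
  Hilbert--Schmidt norm \<open>\<Sum>i. i * |a i|\<^sup>2\<close> is at most \<open>m * M\<^sup>2\<close>. Averaging over tori with Parseval's identity
  gives \<open>\<Sum>k. k\<^sub>j * |c k|\<^sup>2 \<le> m * M\<^sup>2\<close> for every \<open>j\<close>, and the geometric mean of the weights \<open>1 + k\<^sub>j\<close> is at
  most their sum.\<close>

no_notation fps_nth (infixl \<open>$\<close> 75)

section \<open>Taylor expansion on the polydisc\<close>

definition vec_upd :: "'a ^ 'n \<Rightarrow> 'n \<Rightarrow> 'a \<Rightarrow> 'a ^ 'n" where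
  "vec_upd z j w = (\<chi> l. if l = j then w else z $ l)"

lemma vec_upd_nth [simp]: "vec_upd z j w $ l = (if l = j then w else z $ l)"
  by (simp add: vec_upd_def)

lemma vec_upd_triv [simp]: "vec_upd z j (z $ j) = z"
  by (simp add: vec_eq_iff)

lemma vec_upd_same [simp]: "vec_upd (vec_upd z j v) j w = vec_upd z j w"
  by (simp add: vec_eq_iff)

lemma vec_upd_commute: "j \<noteq> l \<Longrightarrow> vec_upd (vec_upd z j v) l w = vec_upd (vec_upd z l w) j v"
  by (auto simp: vec_eq_iff)

lemma vec_upd_in_polydisc [intro]: "z \<in> polydisc \<Longrightarrow> cmod w < 1 \<Longrightarrow> vec_upd z j w \<in> polydisc"
  by (auto simp: polydisc_def)

lemma open_polydisc: "open (polydisc :: (complex ^ 'n) set)"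
proof -
  have "polydisc = (\<Inter>j. {z :: complex ^ 'n. cmod (z $ j) < 1})"
    by (auto simp: polydisc_def)
  also have "open \<dots>"
    by (intro open_INT ballI open_Collect_less continuous_intros) auto
  finally show ?thesis .
qed

text \<open>Holomorphy in each variable separately is stable under locally uniform limits in one
  variable, which is all that the construction of the Taylor coefficients requires.\<close>

definition sep_holomorphic :: "real \<Rightarrow> (complex ^ 'n \<Rightarrow> complex) \<Rightarrow> bool" where
  "sep_holomorphic M f \<longleftrightarrow>
     (\<forall>z\<in>polydisc. cmod (f z) \<le> M \<and> (\<forall>j. (\<lambda>w. f (vec_upd z j w)) holomorphic_on ball 0 1))"

lemma sep_holomorphic_bound: "sep_holomorphic M f \<Longrightarrow> z \<in> polydisc \<Longrightarrow> cmod (f z) \<le> M"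
  by (auto simp: sep_holomorphic_def)

lemma sep_holomorphic_slice:
  "sep_holomorphic M f \<Longrightarrow> z \<in> polydisc \<Longrightarrow> (\<lambda>w. f (vec_upd z j w)) holomorphic_on ball 0 1"
  by (auto simp: sep_holomorphic_def)

lemma multi_holomorphic_imp_sep_holomorphic:
  fixes f :: "complex ^ 'n \<Rightarrow> complex"
  assumes hol: "multi_holomorphic_on f polydisc" and bd: "\<And>z. z \<in> polydisc \<Longrightarrow> cmod (f z) \<le> M"
  shows "sep_holomorphic M f"
  unfolding sep_holomorphic_def
proof (intro ballI conjI allI)
  fix z :: "complex ^ 'n" and j
  assume z: "z \<in> polydisc"
  show "cmod (f z) \<le> M" using bd z .
  have "\<exists>f'. ((\<lambda>w. f (vec_upd z j w)) has_field_derivative f') (at w)" if "w \<in> ball 0 1" for w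
  proof -
    have wz: "vec_upd z j w \<in> polydisc" using z that by auto
    then obtain D where D: "(f has_derivative D) (at (vec_upd z j w) within polydisc)"
      and lin: "\<And>c v. D (c *s v) = c * D v"
      using hol by (auto simp: multi_holomorphic_on_def)
    have D': "(f has_derivative D) (at (vec_upd z j w))"
      using D at_within_open[OF wz open_polydisc] by simp
    \<comment> \<open>The slice map is affine in \<open>v\<close> with direction
      \<open>axis j 1\<close>, so the chain rule and the complex linearity of \<open>D\<close> give
      the slice the complex derivative \<open>D (axis j 1)\<close>.\<close>
    have eq: "vec_upd z j v = vec_upd z j 0 + v *s axis j 1" for v
      by (auto simp: vec_eq_iff axis_def)
    have "bounded_linear (\<lambda>v::complex. v *s (axis j 1 :: complex ^ 'n))"
      by (intro linear_conv_bounded_linear[THEN iffD1] linearI)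
         (auto simp: vec_eq_iff algebra_simps)
    then have "((\<lambda>v. vec_upd z j 0 + v *s axis j 1) has_derivative (\<lambda>v. v *s axis j 1)) (at w)"
      using has_derivative_add[OF has_derivative_const bounded_linear_imp_has_derivative] by fastforce
    then have "((\<lambda>v. vec_upd z j v) has_derivative (\<lambda>v. v *s axis j 1)) (at w)"
      by (simp flip: eq)
    then have "((\<lambda>v. f (vec_upd z j v)) has_derivative (\<lambda>v. D (v *s axis j 1))) (at w)"
      by (rule has_derivative_compose) (rule D')
    then have "((\<lambda>v. f (vec_upd z j v)) has_field_derivative D (axis j 1)) (at w)"
      by (rule has_derivative_imp_has_field_derivative) (simp add: lin)
    then show ?thesis by blast
  qed
  then show "(\<lambda>w. f (vec_upd z j w)) holomorphic_on ball 0 1"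
    by (simp add: holomorphic_on_open)
qed

text \<open>Kept as a function on the whole polydisc although coordinate \<open>j\<close> of
  \<open>z\<close> is overwritten; the expansion can then be iterated over the variables without
  changing types.\<close>

definition taylor_coeff :: "'n \<Rightarrow> nat \<Rightarrow> (complex ^ 'n \<Rightarrow> complex) \<Rightarrow> complex ^ 'n \<Rightarrow> complex" where
  "taylor_coeff j i f z = (deriv ^^ i) (\<lambda>w. f (vec_upd z j w)) 0 / fact i"

lemma taylor_coeff_sums:
  assumes "sep_holomorphic M f" "z \<in> polydisc" "cmod w < 1"
  shows "(\<lambda>i. taylor_coeff j i f z * w ^ i) sums f (vec_upd z j w)"
  using holomorphic_power_series[OF sep_holomorphic_slice[OF assms(1,2)], of w j] assms(3)
  by (simp add: taylor_coeff_def)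

text \<open>Cauchy's inequality on the circle of radius \<open>r < 1\<close>, followed by
  \<open>r\<close> tending to 1. The constant \<open>M\<close> is not worsened, so it survives any
  number of successive expansions.\<close>

lemma taylor_coeff_bound:
  assumes f: "sep_holomorphic M f" and z: "z \<in> polydisc"
  shows "cmod (taylor_coeff j i f z) \<le> M"
proof -
  let ?g = "\<lambda>w. f (vec_upd z j w)"
  have le: "cmod (taylor_coeff j i f z) * r ^ i \<le> M" if r: "0 < r" "r < 1" for r
  proof -
    have "cmod ((deriv ^^ i) ?g 0) \<le> fact i * M / r ^ i"
    proof (rule Cauchy_inequality)
      show "?g holomorphic_on ball 0 r"
        by (rule holomorphic_on_subset[OF sep_holomorphic_slice[OF f z]]) (use r in auto)
      show "continuous_on (cball 0 r) ?g"
        by (rule holomorphic_on_imp_continuous_on,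
            rule holomorphic_on_subset[OF sep_holomorphic_slice[OF f z]]) (use r in auto)
      show "cmod (f (vec_upd z j x)) \<le> M" if "cmod (0 - x) = r" for x
        by (rule sep_holomorphic_bound[OF f]) (use that r z in auto)
    qed (use r in auto)
    then show ?thesis using r
      by (simp add: taylor_coeff_def norm_divide field_simps)
  qed
  have "((\<lambda>r. cmod (taylor_coeff j i f z) * r ^ i) \<longlongrightarrow> cmod (taylor_coeff j i f z) * 1 ^ i) (at_left 1)"
    by (intro tendsto_intros)
  moreover have "eventually (\<lambda>r::real. cmod (taylor_coeff j i f z) * r ^ i \<le> M) (at_left 1)"
    unfolding eventually_at_left_field by (intro exI[of _ 0]) (use le in auto)
  ultimately show ?thesis
    using tendsto_upperbound[of _ _ "at_left 1" M] by fastforce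
qed

text \<open>A Taylor coefficient at 0 sees only the slice near 0. In the iterated expansion this
  shows that the new coefficients no longer depend on coordinate \<open>j\<close>.\<close>

lemma taylor_coeff_eqI:
  assumes "\<And>w. cmod w < 1 \<Longrightarrow> f (vec_upd y j w) = f (vec_upd z j w)"
  shows "taylor_coeff j i f y = taylor_coeff j i f z"
proof -
  have "eventually (\<lambda>w::complex. w \<in> ball 0 1) (nhds 0)"
    by (intro eventually_nhds_in_open) auto
  then have "eventually (\<lambda>w. f (vec_upd y j w) = f (vec_upd z j w)) (nhds 0)"
    by eventually_elim (use assms in auto)
  then show ?thesis
    unfolding taylor_coeff_def by (intro arg_cong2[where f="(/)"] higher_deriv_cong_ev) auto
qed

text \<open>What remains after removing the terms up to \<open>i\<close> is dominated by a geometric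
  series. The bound does not involve \<open>z\<close>, so coefficient \<open>i\<close> is a uniform
  limit of the difference quotients as \<open>x\<close> tends to 0.\<close>

lemma taylor_remainder_bound:
  assumes f: "sep_holomorphic M f" and z: "z \<in> polydisc" and x: "0 < x" "x < 1"
  shows "cmod ((f (vec_upd z j (of_real x)) - (\<Sum>l<i. taylor_coeff j l f z * of_real x ^ l)) / of_real x ^ i
               - taylor_coeff j i f z) \<le> M * x / (1 - x)"
proof -
  let ?t = "\<lambda>l. taylor_coeff j l f z"
  have cx: "cmod (of_real x) < 1" using x by simp
  have "(\<lambda>l. ?t l * of_real x ^ l) sums f (vec_upd z j (of_real x))"
    by (rule taylor_coeff_sums[OF f z cx])
  then have s: "(\<lambda>l. ?t (l + Suc i) * of_real x ^ (l + Suc i)) sums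
     (f (vec_upd z j (of_real x)) - (\<Sum>l<Suc i. ?t l * of_real x ^ l))" (is "?u sums ?R")
    by (subst sums_iff_shift) simp
  have le: "cmod (?u l) \<le> M * x ^ Suc i * x ^ l" for l
    using mult_right_mono[OF taylor_coeff_bound[OF f z, of j "l + Suc i"], of "x ^ (l + Suc i)"] x
    by (simp add: norm_mult norm_power power_add mult_ac)
  have g: "(\<lambda>l. M * x ^ Suc i * x ^ l) sums (M * x ^ Suc i * (1 / (1 - x)))"
    by (intro sums_mult geometric_sums) (use x in auto)
  have "cmod ?R \<le> M * x ^ Suc i * (1 / (1 - x))"
    using norm_suminf_le[OF le sums_summable[OF g]] sums_unique[OF s] sums_unique[OF g] by simp
  then have "cmod ?R / x ^ i \<le> M * x / (1 - x)"
    using x by (simp add: field_simps)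
  moreover have "(f (vec_upd z j (of_real x)) - (\<Sum>l<i. ?t l * of_real x ^ l)) / of_real x ^ i - ?t i
     = ?R / of_real x ^ i"
    using x by (simp add: field_simps)
  ultimately show ?thesis using x by (simp add: norm_divide norm_power)
qed

text \<open>Strong induction on \<open>i\<close>: the quotients approximating coefficient
  \<open>i\<close> are built from \<open>f\<close> at a fixed value of coordinate \<open>j\<close>
  and from lower coefficients, all holomorphic in each variable, and uniform limits preserve
  this.\<close>

lemma sep_holomorphic_taylor_coeff:
  assumes f: "sep_holomorphic M f"
  shows "sep_holomorphic M (taylor_coeff j i f)"
proof (induction i rule: less_induct)
  case (less i)
  have "(\<lambda>w. taylor_coeff j i f (vec_upd z l w)) holomorphic_on ball 0 1" if z: "z \<in> polydisc" for z l
  proof -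
    \<comment> \<open>A sequence in the open unit interval that tends to 0; the summand 2 keeps it
      below 1 already at \<open>s = 0\<close>.\<close>
    define x where "x = (\<lambda>s::nat. 1 / (real s + 2))"
    have x: "0 < x s" "x s < 1" for s by (auto simp: x_def field_simps)
    define h where "h = (\<lambda>s w. (f (vec_upd (vec_upd z l w) j (of_real (x s)))
       - (\<Sum>m<i. taylor_coeff j m f (vec_upd z l w) * of_real (x s) ^ m)) / of_real (x s) ^ i)"
    show ?thesis
    proof (rule holomorphic_uniform_sequence[where f=h])
      show "h s holomorphic_on ball 0 1" for s
      proof -
        have "(\<lambda>w. f (vec_upd (vec_upd z l w) j (of_real (x s)))) holomorphic_on ball 0 1"
        \<comment> \<open>For \<open>l = j\<close> the inner update is overwritten and the function
          is constant in \<open>w\<close>.\<close>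
        proof (cases "l = j")
          case False
          have "(\<lambda>w. f (vec_upd (vec_upd z j (of_real (x s))) l w)) holomorphic_on ball 0 1"
            by (rule sep_holomorphic_slice[OF f]) (use z x[of s] in auto)
          then show ?thesis using False by (simp add: vec_upd_commute)
        qed auto
        moreover have "(\<lambda>w. taylor_coeff j m f (vec_upd z l w)) holomorphic_on ball 0 1" if "m < i" for m
          by (rule sep_holomorphic_slice[OF less.IH[OF that] z])
        ultimately show ?thesis
          unfolding h_def using x[of s] by (intro holomorphic_intros) auto
      qed
      fix w0 :: complex assume "w0 \<in> ball 0 1"
      then obtain d where d: "0 < d" "cball w0 d \<subseteq> ball 0 1"
        using open_contains_cball[of "ball (0::complex) 1"] by blast
      have "uniform_limit (cball w0 d) h (\<lambda>w. taylor_coeff j i f (vec_upd z l w)) sequentially"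
      proof (rule uniform_limitI)
        fix e :: real assume e: "0 < e"
        have "(\<lambda>s. M * x s / (1 - x s)) \<longlonglongrightarrow> M * 0 / (1 - 0)"
          unfolding x_def by (intro tendsto_intros) (real_asymp | simp)+
        then have "eventually (\<lambda>s. M * x s / (1 - x s) < e) sequentially"
          using e by (intro order_tendstoD(2)[where y="M * 0 / (1 - 0)"]) auto
        then show "eventually (\<lambda>s. \<forall>w\<in>cball w0 d.
             dist (h s w) (taylor_coeff j i f (vec_upd z l w)) < e) sequentially"
        proof eventually_elim
          case (elim s)
          show ?case
          proof
            fix w assume "w \<in> cball w0 d"
            then have "w \<in> ball 0 1" using d by blast
            then have "vec_upd z l w \<in> polydisc" using z by auto
            from taylor_remainder_bound[OF f this x[of s], of j i] elim
            show "dist (h s w) (taylor_coeff j i f (vec_upd z l w)) < e"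
              by (simp add: h_def dist_norm)
          qed
        qed
      qed
      with d show "\<exists>d. 0 < d \<and> cball w0 d \<subseteq> ball 0 1 \<and>
          uniform_limit (cball w0 d) h (\<lambda>w. taylor_coeff j i f (vec_upd z l w)) sequentially" by blast
    qed auto
  qed
  then show ?case using taylor_coeff_bound[OF f] by (simp add: sep_holomorphic_def)
qed

section \<open>Absolutely convergent multiple series and the iterated Taylor expansion\<close>

lemma norm_multi_power: "cmod (multi_power z k) = (\<Prod>j\<in>UNIV. cmod (z $ j) ^ (k $ j))"
  by (simp add: multi_power_def prod_norm[symmetric] norm_power)

lemma multi_power_vec_upd:
  "multi_power z (vec_upd k j i) = multi_power z (vec_upd k j 0) * z $ j ^ i"
proof -
  have "multi_power z (vec_upd k j m) = z $ j ^ m * (\<Prod>l\<in>UNIV - {j}. z $ l ^ (k $ l))" for m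
    unfolding multi_power_def by (subst prod.remove[of _ j]) auto
  then show ?thesis by simp
qed

text \<open>A finite set of multi-indices lies in a box, and the sum over a box factors into partial
  sums of one geometric series per variable.\<close>

lemma norm_multi_power_summable:
  assumes "z \<in> polydisc"
  shows "(\<lambda>k :: nat ^ 'n. cmod (multi_power z k)) summable_on UNIV"
proof (rule nonneg_bdd_above_summable_on)
  show "bdd_above (sum (\<lambda>k :: nat ^ 'n. cmod (multi_power z k)) ` {F. F \<subseteq> UNIV \<and> finite F})"
  proof (rule bdd_aboveI2)
    fix F :: "(nat ^ 'n) set" assume "F \<in> {F. F \<subseteq> UNIV \<and> finite F}"
    then have F: "finite F" by simp
    define N where "N = Suc (Max (insert 0 ((\<lambda>(k,j). k $ j) ` (F \<times> UNIV))))"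
    have N: "k $ j < N" if "k \<in> F" for k j
      unfolding N_def less_Suc_eq_le by (rule Max_ge) (use that F in force)+
    have "(\<Sum>k\<in>F. cmod (multi_power z k)) = (\<Sum>g\<in>vec_nth ` F. \<Prod>j\<in>UNIV. cmod (z $ j) ^ g j)"
      by (subst sum.reindex) (auto simp: norm_multi_power inj_on_def vec_eq_iff)
    also have "\<dots> \<le> (\<Sum>g\<in>PiE UNIV (\<lambda>_. {..<N}). \<Prod>j\<in>UNIV. cmod (z $ j) ^ g j)"
      by (intro sum_mono2 finite_PiE) (auto simp: N prod_nonneg)
    also have "\<dots> = (\<Prod>j\<in>UNIV. \<Sum>i<N. cmod (z $ j) ^ i)"
      by (rule prod_sum_PiE[symmetric]) auto
    also have "\<dots> \<le> (\<Prod>j\<in>UNIV. 1 / (1 - cmod (z $ j)))"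
    proof (intro prod_mono conjI sum_nonneg)
      fix j
      have "cmod (z $ j) < 1" using assms by (auto simp: polydisc_def)
      then have "(\<lambda>i. cmod (z $ j) ^ i) sums (1 / (1 - cmod (z $ j)))"
        by (intro geometric_sums) auto
      then show "(\<Sum>i<N. cmod (z $ j) ^ i) \<le> 1 / (1 - cmod (z $ j))"
        using sum_le_suminf[OF sums_summable, of _ _ "{..<N}"] sums_unique by fastforce
    qed auto
    finally show "(\<Sum>k\<in>F. cmod (multi_power z k)) \<le> (\<Prod>j\<in>UNIV. 1 / (1 - cmod (z $ j)))" .
  qed
qed auto

lemma power_series_abs_summable:
  fixes z :: "complex ^ 'n"
  assumes "\<And>k. cmod (c k) \<le> M" "z \<in> polydisc"
  shows "(\<lambda>k. cmod (c k * multi_power z k)) summable_on A"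
proof -
  have "(\<lambda>k. M * cmod (multi_power z k)) summable_on UNIV"
    by (intro summable_on_cmult_right norm_multi_power_summable assms)
  then have "(\<lambda>k. M * cmod (multi_power z k)) summable_on A"
    by (rule summable_on_subset_banach) auto
  then show ?thesis
    by (rule summable_on_comparison_test) (auto simp: norm_mult intro!: mult_right_mono assms)
qed

text \<open>Induction on the set \<open>S\<close> of variables already expanded. The coefficients
  are still functions, but only of the coordinates outside \<open>S\<close>, and the series runs
  over the multi-indices supported in \<open>S\<close>. Adding \<open>j\<close> expands every
  coefficient in that variable.\<close>

lemma sep_holomorphic_expansion_partial:
  fixes S :: "'n::finite set"
  assumes "finite S"
  assumes f: "sep_holomorphic M f"
  shows "\<exists>c. (\<forall>k. sep_holomorphic M (c k)) \<and>
     (\<forall>k. \<forall>y\<in>polydisc. \<forall>z\<in>polydisc. (\<forall>l. l \<notin> S \<longrightarrow> y $ l = z $ l) \<longrightarrow> c k y = c k z) \<and>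
     (\<forall>z\<in>polydisc. ((\<lambda>k. c k z * multi_power z k) has_sum f z) {k. \<forall>l. l \<notin> S \<longrightarrow> k $ l = 0})"
  using assms(1)
proof (induction S)
  case empty
  have *: "{k :: nat ^ 'n. \<forall>l. k $ l = 0} = {0}" by (auto simp: vec_eq_iff)
  have "((\<lambda>k. f z * multi_power z k) has_sum f z) {0}" for z
    using has_sum_finite[of "{0}" "\<lambda>k. f z * multi_power z k"] by (simp add: multi_power_def)
  then show ?case
    using f by (intro exI[of _ "\<lambda>_. f"]) (auto simp: * vec_eq_iff[symmetric])
next
  case (insert j S)
  then obtain c where c: "\<forall>k. sep_holomorphic M (c k)"
    "\<forall>k. \<forall>y\<in>polydisc. \<forall>z\<in>polydisc. (\<forall>l. l \<notin> S \<longrightarrow> y $ l = z $ l) \<longrightarrow> c k y = c k z"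
    "\<forall>z\<in>polydisc. ((\<lambda>k. c k z * multi_power z k) has_sum f z) {k. \<forall>l. l \<notin> S \<longrightarrow> k $ l = 0}"
    by (elim exE conjE)
  have hol: "sep_holomorphic M (c k)" for k
    using c(1) ..
  have ind: "c k y = c k z" if "y \<in> polydisc" "z \<in> polydisc" "\<And>l. l \<notin> S \<Longrightarrow> y $ l = z $ l" for k y z
    using c(2) that by blast
  have sum: "((\<lambda>k. c k z * multi_power z k) has_sum f z) {k. \<forall>l. l \<notin> S \<longrightarrow> k $ l = 0}"
    if "z \<in> polydisc" for z
    using c(3) that ..
  \<comment> \<open>Erasing entry \<open>j\<close> of \<open>k\<close> gives the old coefficient to
    be expanded, and entry \<open>j\<close> tells which of its Taylor coefficients to take.\<close>
  define d where "d = (\<lambda>k. taylor_coeff j (k $ j) (c (vec_upd k j 0)))"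
  let ?A = "\<lambda>S. {k :: nat ^ 'n. \<forall>l. l \<notin> S \<longrightarrow> k $ l = 0}"
  have hol': "sep_holomorphic M (d k)" for k
    unfolding d_def by (intro sep_holomorphic_taylor_coeff hol)
  have ind': "d k y = d k z" if "y \<in> polydisc" "z \<in> polydisc"
     "\<And>l. l \<notin> insert j S \<Longrightarrow> y $ l = z $ l" for k y z
    unfolding d_def by (intro taylor_coeff_eqI ind) (use that in auto)
  have sum': "((\<lambda>k. d k z * multi_power z k) has_sum f z) (?A (insert j S))" if z: "z \<in> polydisc" for z
  proof -
    let ?F = "\<lambda>k. d k z * multi_power z k"
    \<comment> \<open>The uniform bound makes the new series absolutely convergent. Its sum
      \<open>s\<close> is identified afterwards, by summing over the exponent of variable
      \<open>j\<close> first.\<close>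
    have "?F summable_on (?A (insert j S))"
      by (rule abs_summable_summable, rule power_series_abs_summable[OF sep_holomorphic_bound[OF hol' z] z])
    then obtain s where s: "(?F has_sum s) (?A (insert j S))"
      by (auto simp: summable_on_def)
    have fix0: "vec_upd k j 0 = k" if "k \<in> ?A S" for k
      using that insert.hyps by (auto simp: vec_eq_iff)
    \<comment> \<open>A multi-index supported in \<open>insert j S\<close> is the same as one
      supported in \<open>S\<close> together with an exponent \<open>i\<close> for variable
      \<open>j\<close>.\<close>
    have "((\<lambda>(k, i). ?F (vec_upd k j i)) has_sum s) (Sigma (?A S) (\<lambda>_. UNIV)) \<longleftrightarrow>
          (?F has_sum s) (?A (insert j S))"
    proof (rule has_sum_reindex_bij_witness[of _ "\<lambda>k. (vec_upd k j 0, k $ j)" "\<lambda>(k, i). vec_upd k j i"])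
      fix x assume "x \<in> Sigma (?A S) (\<lambda>_. UNIV :: nat set)"
      then obtain k i where x: "x = (k, i)" "k \<in> ?A S" by blast
      then show "(vec_upd (case x of (k, i) \<Rightarrow> vec_upd k j i) j 0, (case x of (k, i) \<Rightarrow> vec_upd k j i) $ j) = x"
        using fix0[of k] by simp
      show "(case x of (k, i) \<Rightarrow> vec_upd k j i) \<in> ?A (insert j S)" using x by simp
      show "?F (case x of (k, i) \<Rightarrow> vec_upd k j i) = (case x of (k, i) \<Rightarrow> ?F (vec_upd k j i))" using x by simp
    qed auto
    with s have "((\<lambda>(k, i). ?F (vec_upd k j i)) has_sum s) (Sigma (?A S) (\<lambda>_. UNIV))" by blast
    then have "((\<lambda>k. c k z * multi_power z k) has_sum s) (?A S)"
    proof (rule has_sum_SigmaD)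
      fix k assume k: "k \<in> ?A S"
      then have k0: "vec_upd k j 0 = k" by (rule fix0)
      have zj: "cmod (z $ j) < 1" using z by (auto simp: polydisc_def)
      have s1: "(\<lambda>i. taylor_coeff j i (c k) z * z $ j ^ i) sums c k z"
        using taylor_coeff_sums[OF hol z zj, of j k] by simp
      have s2: "summable (\<lambda>i. cmod (taylor_coeff j i (c k) z * z $ j ^ i))"
      proof (rule summable_comparison_test')
        show "summable (\<lambda>i. M * cmod (z $ j) ^ i)"
          using zj by (intro summable_mult summable_geometric) auto
        show "norm (cmod (taylor_coeff j i (c k) z * z $ j ^ i)) \<le> M * cmod (z $ j) ^ i" for i
          using taylor_coeff_bound[OF hol z] by (auto simp: norm_mult norm_power intro!: mult_right_mono)
      qed
      have "((\<lambda>i. taylor_coeff j i (c k) z * z $ j ^ i * multi_power z k) has_sum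
              (c k z * multi_power z k)) UNIV"
        by (intro has_sum_cmult_left norm_summable_imp_has_sum s1 s2)
      then show "((\<lambda>y. case (k, y) of (k, i) \<Rightarrow> ?F (vec_upd k j i)) has_sum
              (c k z * multi_power z k)) UNIV"
        using multi_power_vec_upd[of z k j] by (simp add: d_def k0 mult_ac)
    qed
    with sum[OF z] have "s = f z" using has_sum_unique by blast
    with s show ?thesis by simp
  qed
  show ?case using hol' ind' sum' by (intro exI[of _ d]) blast
qed

text \<open>Once all variables are expanded the coefficients are constant on the polydisc, so their
  values at the origin serve.\<close>

lemma sep_holomorphic_expansion:
  fixes f :: "complex ^ 'n \<Rightarrow> complex"
  assumes f: "sep_holomorphic M f"
  obtains c where "\<And>k. cmod (c k) \<le> M"
    "\<And>z. z \<in> polydisc \<Longrightarrow> ((\<lambda>k. c k * multi_power z k) has_sum f z) UNIV"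
proof -
  from sep_holomorphic_expansion_partial[OF finite_class.finite_UNIV f]
  obtain c where c: "\<forall>k. sep_holomorphic M (c k)"
    "\<forall>k. \<forall>y\<in>polydisc. \<forall>z\<in>polydisc. (\<forall>l. l \<notin> UNIV \<longrightarrow> y $ l = z $ l) \<longrightarrow> c k y = c k z"
    "\<forall>z\<in>polydisc. ((\<lambda>k. c k z * multi_power z k) has_sum f z) {k. \<forall>l. l \<notin> UNIV \<longrightarrow> k $ l = 0}"
    by (elim exE conjE)
  have hol: "sep_holomorphic M (c k)" for k
    using c(1) ..
  have ind: "c k y = c k z" if "y \<in> polydisc" "z \<in> polydisc" for k y z
    using c(2) that by blast
  have sum: "((\<lambda>k. c k z * multi_power z k) has_sum f z) UNIV" if "z \<in> polydisc" for z
    using c(3) that by simp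
  have 0: "(0 :: complex ^ 'n) \<in> polydisc" by (simp add: polydisc_def)
  show ?thesis
  proof (rule that[of "\<lambda>k. c k 0"])
    show "cmod (c k 0) \<le> M" for k using sep_holomorphic_bound[OF hol 0] .
    show "((\<lambda>k. c k 0 * multi_power z k) has_sum f z) UNIV" if "z \<in> polydisc" for z
      using sum[OF that] ind[OF that 0] by simp
  qed
qed

section \<open>Discrete Parseval identities\<close>

lemma norm_square_diff_le:
  fixes u v :: complex
  assumes "cmod (u - v) \<le> e" "cmod u \<le> B" "cmod v \<le> B"
  shows "\<bar>(cmod u)\<^sup>2 - (cmod v)\<^sup>2\<bar> \<le> 2 * B * e"
proof -
  have "\<bar>(cmod u)\<^sup>2 - (cmod v)\<^sup>2\<bar> = \<bar>cmod u - cmod v\<bar> * (cmod u + cmod v)"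
    unfolding power2_eq_square square_diff_square_factored by (simp add: abs_mult)
  also have "\<dots> \<le> e * (B + B)"
    using assms norm_triangle_ineq3[of u v] by (intro mult_mono) auto
  finally show ?thesis by (simp add: algebra_simps)
qed

text \<open>Averages over grids of roots of unity replace integration over the torus: for an absolutely
  convergent series they converge to the sum of the squared coefficients.\<close>

lemma discrete_parseval:
  fixes e :: "nat \<Rightarrow> 'k \<Rightarrow> 'x \<Rightarrow> complex" and G :: "nat \<Rightarrow> 'x set" and b :: "'k \<Rightarrow> complex"
  assumes fin: "\<And>N. finite (G N)"
    and e1: "\<And>N k x. cmod (e N k x) \<le> 1"
    and orth: "\<And>k l. eventually (\<lambda>N. (\<Sum>x\<in>G N. e N k x * cnj (e N l x)) =
                  (if k = l then of_nat (card (G N)) else 0)) sequentially"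
    and ne: "eventually (\<lambda>N. card (G N) > 0) sequentially"
    and b: "(\<lambda>k. cmod (b k)) summable_on UNIV"
  shows "(\<lambda>N. (\<Sum>x\<in>G N. (cmod (\<Sum>\<^sub>\<infinity>k. b k * e N k x))\<^sup>2) / card (G N))
           \<longlonglongrightarrow> (\<Sum>\<^sub>\<infinity>k. (cmod (b k))\<^sup>2)"
proof (rule LIMSEQ_I)
  fix \<epsilon> :: real assume "0 < \<epsilon>"
  define B where "B = (\<Sum>\<^sub>\<infinity>k. cmod (b k))"
  have B0: "0 \<le> B" unfolding B_def by (intro infsum_nonneg) auto
  have bB: "cmod (b k) \<le> B" for k
    using finite_sum_le_infsum[OF b, of "{k}"] by (simp add: B_def)
  \<comment> \<open>Truncating the series to \<open>K\<close> costs \<open>2 * B * \<delta>\<close>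
    in the averages and \<open>B * \<delta>\<close> in the sum of squares, together less than
    \<open>\<epsilon>\<close>; the summand 1 covers \<open>B = 0\<close>.\<close>
  define \<delta> where "\<delta> = \<epsilon> / (4 * (B + 1))"
  have \<delta>: "0 < \<delta>" using \<open>0 < \<epsilon>\<close> B0 by (simp add: \<delta>_def)
  have sq: "(\<lambda>k. (cmod (b k))\<^sup>2) summable_on UNIV"
    by (rule summable_on_comparison_test[OF summable_on_cmult_right[OF b, of B]])
       (auto simp: power2_eq_square intro!: mult_right_mono bB)
  obtain K where K: "finite K" and KB: "dist (sum (\<lambda>k. cmod (b k)) K) B \<le> \<delta>"
    using infsum_finite_approximation[OF b \<delta>] by (auto simp: B_def)
  have tail: "(\<Sum>\<^sub>\<infinity>k\<in>-K. cmod (b k)) \<le> \<delta>"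
  proof -
    have "B = (\<Sum>k\<in>K. cmod (b k)) + (\<Sum>\<^sub>\<infinity>k\<in>-K. cmod (b k))"
      using infsum_Un_disjoint[of "\<lambda>k. cmod (b k)" K "-K"] K
        summable_on_subset_banach[OF b, of "-K"] by (simp add: B_def)
    then show ?thesis using KB by (simp add: dist_norm)
  qed
  have sqtail: "\<bar>(\<Sum>k\<in>K. (cmod (b k))\<^sup>2) - (\<Sum>\<^sub>\<infinity>k. (cmod (b k))\<^sup>2)\<bar> \<le> B * \<delta>"
  proof -
    have "(\<Sum>\<^sub>\<infinity>k. (cmod (b k))\<^sup>2) = (\<Sum>k\<in>K. (cmod (b k))\<^sup>2) + (\<Sum>\<^sub>\<infinity>k\<in>-K. (cmod (b k))\<^sup>2)"
      using infsum_Un_disjoint[of "\<lambda>k. (cmod (b k))\<^sup>2" K "-K"] K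
        summable_on_subset_banach[OF sq, of "-K"] by simp
    moreover have "(\<Sum>\<^sub>\<infinity>k\<in>-K. (cmod (b k))\<^sup>2) \<le> (\<Sum>\<^sub>\<infinity>k\<in>-K. B * cmod (b k))"
      by (intro infsum_mono summable_on_subset_banach[OF sq]
           summable_on_subset_banach[OF summable_on_cmult_right[OF b]])
         (auto simp: power2_eq_square intro!: mult_right_mono bB)
    moreover have "(\<Sum>\<^sub>\<infinity>k\<in>-K. B * cmod (b k)) \<le> B * \<delta>"
      using tail B0 by (simp add: infsum_cmult_right' mult_left_mono)
    moreover have "0 \<le> (\<Sum>\<^sub>\<infinity>k\<in>-K. (cmod (b k))\<^sup>2)" by (intro infsum_nonneg) auto
    ultimately show ?thesis by simp
  qed
  define g where "g = (\<lambda>N x. \<Sum>\<^sub>\<infinity>k. b k * e N k x)"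
  define h where "h = (\<lambda>N x. \<Sum>k\<in>K. b k * e N k x)"
  have be: "cmod (b k * e N k x) \<le> cmod (b k)" for N k x
    using e1[of N k x] by (simp add: norm_mult mult_left_le)
  have be_abs: "(\<lambda>k. cmod (b k * e N k x)) summable_on A" for N x A
    by (rule summable_on_comparison_test[OF summable_on_subset_banach[OF b]]) (use be in auto)
  have be_sum: "(\<lambda>k. b k * e N k x) summable_on A" for N x A
    using be_abs by (rule abs_summable_summable)
  have norm_le: "cmod (\<Sum>\<^sub>\<infinity>k\<in>A. b k * e N k x) \<le> (\<Sum>\<^sub>\<infinity>k\<in>A. cmod (b k))" for N x A
    by (rule order_trans[OF norm_infsum_bound[OF be_abs]])
       (intro infsum_mono be_abs summable_on_subset_banach[OF b] be, auto)
  have gB: "cmod (g N x) \<le> B" for N x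
    unfolding g_def B_def by (rule norm_le)
  have hB: "cmod (h N x) \<le> B" for N x
    using norm_le[of N x K] K finite_sum_le_infsum[OF b K] by (simp add: h_def B_def)
  have gh: "cmod (g N x - h N x) \<le> \<delta>" for N x
  proof -
    have "g N x = h N x + (\<Sum>\<^sub>\<infinity>k\<in>-K. b k * e N k x)"
      using infsum_Un_disjoint[of "\<lambda>k. b k * e N k x" K "-K"] K be_sum by (simp add: g_def h_def)
    then show ?thesis using order_trans[OF norm_le[of N x "-K"] tail] by simp
  qed
  have "eventually (\<lambda>N. \<forall>(k, l)\<in>K \<times> K. (\<Sum>x\<in>G N. e N k x * cnj (e N l x)) =
                  (if k = l then of_nat (card (G N)) else 0)) sequentially"
    using K orth by (intro eventually_ball_finite) auto
  \<comment> \<open>\<open>K\<close> is finite, so for large \<open>N\<close> orthogonality holds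
    for all pairs from \<open>K\<close> at once, and Parseval for the truncation is then an exact
    identity.\<close>
  then have hN: "eventually (\<lambda>N. (\<Sum>x\<in>G N. (cmod (h N x))\<^sup>2) = card (G N) * (\<Sum>k\<in>K. (cmod (b k))\<^sup>2)) sequentially"
  proof eventually_elim
    case (elim N)
    have "complex_of_real (\<Sum>x\<in>G N. (cmod (h N x))\<^sup>2) =
          (\<Sum>x\<in>G N. \<Sum>k\<in>K. \<Sum>l\<in>K. b k * cnj (b l) * (e N k x * cnj (e N l x)))"
      unfolding of_real_sum
      by (intro sum.cong refl) (simp only: h_def complex_norm_square cnj_sum sum_product complex_cnj_mult mult_ac)
    also have "\<dots> = (\<Sum>k\<in>K. \<Sum>l\<in>K. b k * cnj (b l) * (\<Sum>x\<in>G N. e N k x * cnj (e N l x)))"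
      by (subst sum.swap, intro sum.cong refl, subst sum.swap) (simp add: sum_distrib_left)
    also have "\<dots> = (\<Sum>k\<in>K. \<Sum>l\<in>K. if k = l then b k * cnj (b l) * of_nat (card (G N)) else 0)"
      using elim by (intro sum.cong refl) auto
    also have "\<dots> = of_real (card (G N) * (\<Sum>k\<in>K. (cmod (b k))\<^sup>2))"
      using K by (simp add: sum_distrib_left mult.commute flip: complex_norm_square)
    finally show ?case by (simp only: of_real_eq_iff)
  qed
  have "eventually (\<lambda>N. norm ((\<Sum>x\<in>G N. (cmod (g N x))\<^sup>2) / card (G N) - (\<Sum>\<^sub>\<infinity>k. (cmod (b k))\<^sup>2)) < \<epsilon>) sequentially"
    using ne hN
  proof eventually_elim
    case (elim N)
    have "\<bar>(\<Sum>x\<in>G N. (cmod (g N x))\<^sup>2) - (\<Sum>x\<in>G N. (cmod (h N x))\<^sup>2)\<bar>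
            \<le> (\<Sum>x\<in>G N. \<bar>(cmod (g N x))\<^sup>2 - (cmod (h N x))\<^sup>2\<bar>)"
      by (simp add: sum_subtractf[symmetric] sum_abs)
    also have "\<dots> \<le> (\<Sum>x\<in>G N. 2 * B * \<delta>)"
      by (intro sum_mono norm_square_diff_le gh gB hB)
    finally have "\<bar>(\<Sum>x\<in>G N. (cmod (g N x))\<^sup>2) - card (G N) * (\<Sum>k\<in>K. (cmod (b k))\<^sup>2)\<bar> \<le> card (G N) * (2 * B * \<delta>)"
      using elim by simp
    then have "\<bar>(\<Sum>x\<in>G N. (cmod (g N x))\<^sup>2) - card (G N) * (\<Sum>k\<in>K. (cmod (b k))\<^sup>2)\<bar> / card (G N) \<le> 2 * B * \<delta>"
      using elim by (simp add: field_simps)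
    also have "\<bar>(\<Sum>x\<in>G N. (cmod (g N x))\<^sup>2) - card (G N) * (\<Sum>k\<in>K. (cmod (b k))\<^sup>2)\<bar> / card (G N)
        = \<bar>(\<Sum>x\<in>G N. (cmod (g N x))\<^sup>2) / card (G N) - (\<Sum>k\<in>K. (cmod (b k))\<^sup>2)\<bar>"
      using elim by (simp add: field_simps flip: abs_div_pos)
    finally have "\<bar>(\<Sum>x\<in>G N. (cmod (g N x))\<^sup>2) / card (G N) - (\<Sum>\<^sub>\<infinity>k. (cmod (b k))\<^sup>2)\<bar> \<le> 3 * (B * \<delta>)"
      using sqtail by linarith
    also have "3 * (B * \<delta>) < \<epsilon>"
    proof -
      have "3 * B < 4 * (B + 1)" using B0 by simp
      then have "3 * B * \<epsilon> < 4 * (B + 1) * \<epsilon>" using \<open>0 < \<epsilon>\<close> by (intro mult_strict_right_mono)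
      then show ?thesis using B0 by (simp add: \<delta>_def field_simps)
    qed
    finally show ?case by simp
  qed
  then show "\<exists>N0. \<forall>N\<ge>N0. norm ((\<Sum>x\<in>G N. (cmod (\<Sum>\<^sub>\<infinity>k. b k * e N k x))\<^sup>2) / card (G N)
      - (\<Sum>\<^sub>\<infinity>k. (cmod (b k))\<^sup>2)) < \<epsilon>"
    by (simp only: g_def eventually_sequentially)
qed

section \<open>Roots of unity as sampling points on circles and tori\<close>

definition unity_root :: "nat \<Rightarrow> nat \<Rightarrow> complex" where
  "unity_root N t = cis (2 * pi * real t / real N)"

lemma norm_unity_root [simp]: "cmod (unity_root N t) = 1"
  by (simp add: unity_root_def)

text \<open>Exchanging index and exponent of the root turns the sum into a geometric one with ratio
  \<open>\<xi>\<close>. For distinct \<open>k\<close> and \<open>l\<close> below \<open>N\<close>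
  this ratio is an \<open>N\<close>-th root of unity other than 1, so the sum vanishes.\<close>

lemma unity_root_orthogonal:
  assumes "k < N" "l < N"
  shows "(\<Sum>t<N. unity_root N t ^ k * cnj (unity_root N t ^ l)) = (if k = l then of_nat N else 0)"
proof (cases "k = l")
  case True
  have "unity_root N t ^ k * cnj (unity_root N t ^ k) = 1" for t
    by (metis complex_norm_square norm_power norm_unity_root of_real_1 power_one)
  then show ?thesis using True by simp
next
  case False
  define \<xi> where "\<xi> = unity_root N k / unity_root N l"
  have N: "N > 0" using assms by simp
  have eq: "unity_root N m = exp (2 * of_real pi * \<i> * of_nat m / of_nat N)" for m
    by (simp add: unity_root_def cis_conv_exp mult_ac)
  have pow: "unity_root N m ^ N = 1" for m
  proof -
    have "real N * (2 * pi * real m / real N) = 2 * pi * real m" using N by simp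
    then show ?thesis
      using cis_multiple_2pi[of "real m"] by (simp only: unity_root_def Complex.DeMoivre Ints_of_nat)
  qed
  have nz: "unity_root N m \<noteq> 0" for m by (simp add: unity_root_def)
  have "unity_root N k \<noteq> unity_root N l"
    using False assms N by (simp add: eq complex_root_unity_eq)
  then have "\<xi> \<noteq> 1" using nz by (simp add: \<xi>_def)
  moreover have "\<xi> ^ N = 1" by (simp add: \<xi>_def power_divide pow)
  moreover have "unity_root N t ^ k * cnj (unity_root N t ^ l) = \<xi> ^ t" for t
    by (simp add: \<xi>_def unity_root_def Complex.DeMoivre power_divide cis_divide cis_mult cis_cnj diff_divide_distrib
      algebra_simps)
  ultimately show ?thesis using False by (simp add: geometric_sum)
qed

lemma parseval_power_series:
  assumes d: "(\<lambda>k. cmod (d k)) summable_on UNIV"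
  shows "(\<lambda>N. (\<Sum>t<N. (cmod (\<Sum>\<^sub>\<infinity>k. d k * unity_root N t ^ k))\<^sup>2) / N)
           \<longlonglongrightarrow> (\<Sum>\<^sub>\<infinity>k. (cmod (d k))\<^sup>2)"
proof -
  have "(\<lambda>N. (\<Sum>t\<in>{..<N}. (cmod (\<Sum>\<^sub>\<infinity>k. d k * unity_root N t ^ k))\<^sup>2) / card {..<N})
           \<longlonglongrightarrow> (\<Sum>\<^sub>\<infinity>k. (cmod (d k))\<^sup>2)"
  proof (rule discrete_parseval)
    show "eventually (\<lambda>N. (\<Sum>x<N. unity_root N x ^ k * cnj (unity_root N x ^ l)) =
            (if k = l then of_nat (card {..<N}) else 0)) sequentially" for k l
      using eventually_gt_at_top[of "max k l"]
      by eventually_elim (use unity_root_orthogonal in auto)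
    show "eventually (\<lambda>N. card {..<N} > 0) sequentially"
      using eventually_gt_at_top[of 0] by eventually_elim auto
  qed (auto simp: norm_power d)
  then show ?thesis by simp
qed

definition unity_grid :: "nat \<Rightarrow> ('n \<Rightarrow> nat) \<Rightarrow> complex ^ 'n" where
  "unity_grid N x = (\<chi> j. unity_root N (x j))"

lemma parseval_multi:
  fixes d :: "nat ^ 'n \<Rightarrow> complex"
  assumes d: "(\<lambda>k. cmod (d k)) summable_on UNIV"
  shows "(\<lambda>N. (\<Sum>x\<in>(UNIV :: 'n set) \<rightarrow>\<^sub>E {..<N}. (cmod (\<Sum>\<^sub>\<infinity>k. d k * multi_power (unity_grid N x) k))\<^sup>2)
             / card ((UNIV :: 'n set) \<rightarrow>\<^sub>E {..<N}))
           \<longlonglongrightarrow> (\<Sum>\<^sub>\<infinity>k. (cmod (d k))\<^sup>2)"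
proof (rule discrete_parseval)
  have card: "card ((UNIV :: 'n set) \<rightarrow>\<^sub>E {..<N}) = N ^ CARD('n)" for N :: nat
    by (simp add: card_PiE)
  show "eventually (\<lambda>N. card ((UNIV :: 'n set) \<rightarrow>\<^sub>E {..<N}) > 0) sequentially"
    using eventually_gt_at_top[of 0] by eventually_elim (auto simp: card)
  show "cmod (multi_power (unity_grid N x) k) \<le> 1" for N x and k :: "nat ^ 'n"
    by (simp add: norm_multi_power unity_grid_def)
  show "eventually (\<lambda>N. (\<Sum>x\<in>UNIV \<rightarrow>\<^sub>E {..<N}. multi_power (unity_grid N x) k * cnj (multi_power (unity_grid N x) l)) =
       (if k = l then of_nat (card ((UNIV :: 'n set) \<rightarrow>\<^sub>E {..<N})) else 0)) sequentially" for k l :: "nat ^ 'n"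
  proof -
    \<comment> \<open>From here on no two distinct exponents are aliased modulo \<open>N\<close>,
      and the grid sum factors into one-dimensional ones.\<close>
    have "eventually (\<lambda>N. \<forall>j. k $ j < N \<and> l $ j < N) sequentially"
      by (intro eventually_all_finite eventually_conj eventually_gt_at_top)
    then show ?thesis
    proof eventually_elim
      case (elim N)
      have "(\<Sum>x\<in>UNIV \<rightarrow>\<^sub>E {..<N}. multi_power (unity_grid N x) k * cnj (multi_power (unity_grid N x) l)) =
        (\<Sum>x\<in>UNIV \<rightarrow>\<^sub>E {..<N}. \<Prod>j\<in>UNIV. unity_root N (x j) ^ (k $ j) * cnj (unity_root N (x j) ^ (l $ j)))"
        by (simp add: multi_power_def unity_grid_def prod.distrib)
      also have "\<dots> = (\<Prod>j\<in>UNIV. \<Sum>t<N. unity_root N t ^ (k $ j) * cnj (unity_root N t ^ (l $ j)))"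
        by (rule prod_sum_PiE[symmetric]) auto
      also have "\<dots> = (\<Prod>j\<in>UNIV. if k $ j = l $ j then of_nat N else 0)"
        using elim by (intro prod.cong refl unity_root_orthogonal) auto
      also have "\<dots> = (if k = l then of_nat (card ((UNIV :: 'n set) \<rightarrow>\<^sub>E {..<N})) else 0)"
        by (auto simp: card vec_eq_iff)
      finally show ?case .
    qed
  qed
qed (auto simp: d intro: finite_PiE)

section \<open>Hankel matrices of bounded rational functions\<close>

lemma pythagoras_complex:
  fixes w x :: "nat \<Rightarrow> complex"
  assumes w: "(\<Sum>j<N. (cmod (w j))\<^sup>2) = 1" and c: "c = (\<Sum>j<N. x j * cnj (w j))"
  shows "(\<Sum>j<N. (cmod (x j - c * w j))\<^sup>2) = (\<Sum>j<N. (cmod (x j))\<^sup>2) - (cmod c)\<^sup>2"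
proof -
  have w': "(\<Sum>j<N. w j * cnj (w j)) = 1"
    using arg_cong[OF w, of complex_of_real] by (simp add: of_real_sum flip: complex_norm_square)
  have c': "cnj c = (\<Sum>j<N. cnj (x j) * w j)" by (simp add: c cnj_sum)
  have "complex_of_real (\<Sum>j<N. (cmod (x j - c * w j))\<^sup>2) =
     (\<Sum>j<N. x j * cnj (x j) - cnj c * (x j * cnj (w j)) - c * (cnj (x j) * w j) + c * cnj c * (w j * cnj (w j)))"
    unfolding of_real_sum complex_norm_square
    by (intro sum.cong refl) (simp add: algebra_simps)
  also have "\<dots> = (\<Sum>j<N. x j * cnj (x j)) - cnj c * c - c * cnj c + c * cnj c * 1"
    by (simp only: sum.distrib sum_subtractf sum_distrib_left[symmetric] w' c[symmetric] c'[symmetric])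
  also have "\<dots> = complex_of_real ((\<Sum>j<N. (cmod (x j))\<^sup>2) - (cmod c)\<^sup>2)"
    by (simp only: of_real_diff of_real_sum complex_norm_square) (simp add: mult.commute)
  finally show ?thesis by (simp only: of_real_eq_iff)
qed

text \<open>\<open>B\<close> bounds the squared operator norm and \<open>m\<close> the rank.
  Induction on \<open>m\<close>: projecting all rows off one generator \<open>g m\<close> lowers the
  rank bound by one, keeps the operator bound, and costs at most \<open>B\<close> of the squared
  Hilbert-Schmidt norm.\<close>

lemma hilbert_schmidt_le_rank:
  fixes h t g :: "nat \<Rightarrow> nat \<Rightarrow> complex"
  assumes "0 \<le> B"
    and "\<And>i j. i < I \<Longrightarrow> j < N \<Longrightarrow> h i j = (\<Sum>s<m. t i s * g s j)"
    and "\<And>x. (\<Sum>i<I. (cmod (\<Sum>j<N. h i j * x j))\<^sup>2) \<le> B * (\<Sum>j<N. (cmod (x j))\<^sup>2)"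
  shows "(\<Sum>i<I. \<Sum>j<N. (cmod (h i j))\<^sup>2) \<le> m * B"
  using assms(2,3)
proof (induction m arbitrary: h g)
  case 0
  then show ?case by simp
next
  case (Suc m)
  note rep = Suc.prems(1) and op = Suc.prems(2)
  define G where "G = (\<Sum>j<N. (cmod (g m j))\<^sup>2)"
  have G0: "0 \<le> G" unfolding G_def by (intro sum_nonneg) auto
  show ?case
  proof (cases "G = 0")
    case True
    then have "g m j = 0" if "j < N" for j
      using that by (simp add: G_def sum_nonneg_eq_0_iff)
    then have "(\<Sum>i<I. \<Sum>j<N. (cmod (h i j))\<^sup>2) \<le> m * B"
      by (intro Suc.IH[of h g] op) (simp add: rep)
    then show ?thesis using assms(1) by (simp add: algebra_simps)
  next
    case False
    with G0 have G: "0 < G" by simp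
    \<comment> \<open>With the conjugate, \<open>p (h i)\<close> is both entry \<open>i\<close> of
      the matrix applied to the unit vector \<open>w\<close> and the component of row
      \<open>i\<close> along \<open>g m\<close>. The first reading bounds the loss by
      \<open>B\<close>; in the second, \<open>P\<close> removes that component.\<close>
    define w where "w = (\<lambda>j. cnj (g m j) / sqrt G)"
    have w1: "(\<Sum>j<N. (cmod (w j))\<^sup>2) = 1"
      using G by (simp add: w_def norm_divide power_divide G_def flip: sum_divide_distrib)
    then have w1': "(\<Sum>j<N. (cmod (cnj (w j)))\<^sup>2) = 1" by simp
    define p where "p = (\<lambda>v :: nat \<Rightarrow> complex. \<Sum>l<N. v l * w l)"
    define P where "P = (\<lambda>v j. v j - p v * cnj (w j))"
    have gm: "P (g m) j = 0" for j
    proof -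
      have "p (g m) = of_real G / of_real (sqrt G)"
        by (simp add: p_def w_def G_def complex_norm_square sum_divide_distrib del: of_real_power)
      also have "\<dots> = of_real (sqrt G)"
        using G by (simp add: real_div_sqrt flip: of_real_divide)
      finally show ?thesis using G by (simp add: P_def w_def)
    qed
    have rep': "P (h i) j = (\<Sum>s<m. t i s * P (g s) j)" if ij: "i < I" "j < N" for i j
    proof -
      have "p (h i) = (\<Sum>l<N. \<Sum>s<Suc m. t i s * (g s l * w l))"
        unfolding p_def using ij by (intro sum.cong refl) (simp add: rep sum_distrib_right mult.assoc del: sum.lessThan_Suc)
      also have "\<dots> = (\<Sum>s<Suc m. t i s * p (g s))"
        by (subst sum.swap) (simp add: p_def sum_distrib_left del: sum.lessThan_Suc)
      finally have "P (h i) j = (\<Sum>s<Suc m. t i s * P (g s) j)"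
        unfolding P_def right_diff_distrib sum_subtractf
        by (simp only: rep[OF ij] sum_distrib_right mult.assoc)
      then show ?thesis using gm by simp
    qed
    \<comment> \<open>Projecting the rows amounts to applying the old matrix to the projection of
      \<open>x\<close>, which is no longer than \<open>x\<close>.\<close>
    have op': "(\<Sum>i<I. (cmod (\<Sum>j<N. P (h i) j * x j))\<^sup>2) \<le> B * (\<Sum>j<N. (cmod (x j))\<^sup>2)" for x
    proof -
      define c where "c = (\<Sum>j<N. x j * cnj (w j))"
      have "(\<Sum>j<N. P (h i) j * x j) = (\<Sum>j<N. h i j * (x j - c * w j))" for i
      proof -
        have "(\<Sum>j<N. P (h i) j * x j) = (\<Sum>j<N. h i j * x j) - p (h i) * c"
          by (simp add: P_def c_def sum_subtractf sum_distrib_left algebra_simps)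
        also have "p (h i) * c = (\<Sum>j<N. h i j * (c * w j))"
          by (simp add: p_def sum_distrib_left sum_distrib_right mult_ac)
        finally show ?thesis by (simp add: right_diff_distrib sum_subtractf)
      qed
      then have "(\<Sum>i<I. (cmod (\<Sum>j<N. P (h i) j * x j))\<^sup>2) \<le> B * (\<Sum>j<N. (cmod (x j - c * w j))\<^sup>2)"
        using op[of "\<lambda>j. x j - c * w j"] by simp
      also have "\<dots> \<le> B * (\<Sum>j<N. (cmod (x j))\<^sup>2)"
        using pythagoras_complex[OF w1 c_def] assms(1) by (intro mult_left_mono) auto
      finally show ?thesis .
    qed
    have "(\<Sum>i<I. \<Sum>j<N. (cmod (P (h i) j))\<^sup>2) \<le> m * B"
      by (rule Suc.IH[of "\<lambda>i. P (h i)" "\<lambda>s. P (g s)"]) (use rep' op' in auto)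
    moreover have "(\<Sum>j<N. (cmod (P (h i) j))\<^sup>2) = (\<Sum>j<N. (cmod (h i j))\<^sup>2) - (cmod (p (h i)))\<^sup>2" for i
      using pythagoras_complex[OF w1', of "p (h i)" "h i"] by (simp add: P_def p_def)
    moreover have "(\<Sum>i<I. (cmod (p (h i)))\<^sup>2) \<le> B"
      using op[of w] w1 by (simp add: p_def)
    ultimately show ?thesis by (simp add: sum_subtractf algebra_simps)
  qed
qed

section \<open>Parseval on circles and the operator norm of the Hankel matrix\<close>

lemma sums_power_series_shift:
  fixes a :: "nat \<Rightarrow> complex"
  assumes "(\<lambda>i. a i * u ^ i) sums F"
  shows "(\<lambda>k. (if k < s then 0 else a (k - s)) * u ^ k) sums (u ^ s * F)"
proof -
  have "(\<lambda>i. u ^ s * (a i * u ^ i)) sums (u ^ s * F)" by (intro sums_mult assms)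
  then show ?thesis
    by (subst sums_zero_iff_shift[symmetric, where n=s]) (auto simp: power_add mult_ac)
qed

lemma power_series_scaled:
  fixes d :: "nat \<Rightarrow> complex"
  assumes sums: "\<And>u. cmod u < 1 \<Longrightarrow> (\<lambda>k. d k * u ^ k) sums F u" and r: "0 < r" "r < 1"
  shows "(\<lambda>k. cmod (d k * of_real r ^ k)) summable_on UNIV"
    and "cmod \<omega> = 1 \<Longrightarrow> (\<Sum>\<^sub>\<infinity>k. d k * of_real r ^ k * \<omega> ^ k) = F (of_real r * \<omega>)"
proof -
  \<comment> \<open>Mere convergence at a larger radius yields absolute convergence at
    \<open>r\<close>.\<close>
  obtain \<rho> where \<rho>: "r < \<rho>" "\<rho> < 1" using dense[OF r(2)] by blast
  have "summable (\<lambda>k. d k * complex_of_real \<rho> ^ k)"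
    using sums[of "of_real \<rho>"] \<rho> r by (auto simp: sums_iff)
  then have s: "summable (\<lambda>k. cmod (d k * of_real r ^ k))"
    by (rule powser_insidea) (use \<rho> r in auto)
  then show "(\<lambda>k. cmod (d k * of_real r ^ k)) summable_on UNIV"
    by (simp add: summable_on_UNIV_nonneg_real_iff)
  assume \<omega>: "cmod \<omega> = 1"
  have "((\<lambda>k. d k * (of_real r * \<omega>) ^ k) has_sum F (of_real r * \<omega>)) UNIV"
  proof (rule norm_summable_imp_has_sum)
    show "summable (\<lambda>k. cmod (d k * (of_real r * \<omega>) ^ k))"
      using s \<omega> by (simp add: norm_mult norm_power)
    show "(\<lambda>k. d k * (of_real r * \<omega>) ^ k) sums F (of_real r * \<omega>)"
      by (rule sums) (use r \<omega> in \<open>simp add: norm_mult\<close>)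
  qed
  then show "(\<Sum>\<^sub>\<infinity>k. d k * of_real r ^ k * \<omega> ^ k) = F (of_real r * \<omega>)"
    by (simp add: infsumI power_mult_distrib mult.assoc)
qed

text \<open>The pointwise inequality is averaged over the circle of radius \<open>r\<close> and both
  sides are evaluated by Parseval. Since \<open>K\<close> is finite, \<open>r\<close> may then tend
  to 1.\<close>

lemma coeff_sum_le_of_norm_le:
  fixes d e :: "nat \<Rightarrow> complex"
  assumes d: "\<And>u. cmod u < 1 \<Longrightarrow> (\<lambda>k. d k * u ^ k) sums F u"
    and le: "\<And>u. cmod u < 1 \<Longrightarrow> cmod (F u) \<le> M * cmod (\<Sum>k<N. e k * u ^ k)"
    and K: "finite K"
  shows "(\<Sum>k\<in>K. (cmod (d k))\<^sup>2) \<le> M\<^sup>2 * (\<Sum>k<N. (cmod (e k))\<^sup>2)"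
proof -
  have r: "(\<Sum>k\<in>K. (cmod (d k) * r ^ k)\<^sup>2) \<le> M\<^sup>2 * (\<Sum>k<N. (cmod (e k))\<^sup>2)" if r: "0 < r" "r < 1" for r
  proof -
    define X where "X = (\<lambda>u. \<Sum>k<N. e k * u ^ k)"
    define e' where "e' = (\<lambda>k. if k < N then e k else 0)"
    have e': "(\<lambda>k. e' k * u ^ k) sums X u" for u
      unfolding X_def e'_def using sums_If_finite_set[of "{..<N}" "\<lambda>k. e k * u ^ k"]
      by (simp add: if_distrib[of "\<lambda>x. x * _"] cong: if_cong)
    note sd = power_series_scaled[OF d r] and se = power_series_scaled[OF e' r]
    have "(\<Sum>\<^sub>\<infinity>k. (cmod (d k * of_real r ^ k))\<^sup>2) \<le> M\<^sup>2 * (\<Sum>\<^sub>\<infinity>k. (cmod (e' k * of_real r ^ k))\<^sup>2)"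
    proof (rule LIMSEQ_le[OF parseval_power_series[OF sd(1)] tendsto_mult_left[OF parseval_power_series[OF se(1)]]])
      have "(cmod (F (of_real r * \<omega>)))\<^sup>2 \<le> M\<^sup>2 * (cmod (X (of_real r * \<omega>)))\<^sup>2" if "cmod \<omega> = 1" for \<omega>
        using power_mono[OF le[of "of_real r * \<omega>"], of 2] r that
        by (simp add: X_def norm_mult power_mult_distrib)
      then show "\<exists>N0. \<forall>n\<ge>N0. (\<Sum>t<n. (cmod (\<Sum>\<^sub>\<infinity>k. d k * of_real r ^ k * unity_root n t ^ k))\<^sup>2) / n
          \<le> M\<^sup>2 * ((\<Sum>t<n. (cmod (\<Sum>\<^sub>\<infinity>k. e' k * of_real r ^ k * unity_root n t ^ k))\<^sup>2) / n)"
        by (simp add: sd(2) se(2) sum_distrib_left sum_mono divide_right_mono)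
    qed
    also have "(\<Sum>\<^sub>\<infinity>k. (cmod (e' k * of_real r ^ k))\<^sup>2) = (\<Sum>k<N. (cmod (e k * of_real r ^ k))\<^sup>2)"
      by (subst infsum_cong_neutral[where T="{..<N}" and g="\<lambda>k. (cmod (e k * of_real r ^ k))\<^sup>2"])
         (auto simp: e'_def)
    also have "\<dots> \<le> (\<Sum>k<N. (cmod (e k))\<^sup>2)"
      using r by (intro sum_mono power_mono) (auto simp: norm_mult norm_power power_le_one mult_left_le)
    finally have "(\<Sum>\<^sub>\<infinity>k. (cmod (d k * of_real r ^ k))\<^sup>2) \<le> M\<^sup>2 * (\<Sum>k<N. (cmod (e k))\<^sup>2)"
      by (simp add: mult_left_mono)
    moreover have "(\<Sum>k\<in>K. (cmod (d k * of_real r ^ k))\<^sup>2) \<le> (\<Sum>\<^sub>\<infinity>k. (cmod (d k * of_real r ^ k))\<^sup>2)"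
    proof (rule finite_sum_le_infsum)
      have bd: "cmod (d k * of_real r ^ k) \<le> (\<Sum>\<^sub>\<infinity>k. cmod (d k * of_real r ^ k))" for k
        using finite_sum_le_infsum[OF sd(1), of "{k}"] by simp
      show "(\<lambda>k. (cmod (d k * of_real r ^ k))\<^sup>2) summable_on UNIV"
        by (rule summable_on_comparison_test[OF summable_on_cmult_right[OF sd(1)]])
           (auto simp: power2_eq_square intro!: mult_right_mono bd)
    qed (use K in auto)
    ultimately show ?thesis using r by (simp add: norm_mult norm_power)
  qed
  have "((\<lambda>r. \<Sum>k\<in>K. (cmod (d k) * r ^ k)\<^sup>2) \<longlongrightarrow> (\<Sum>k\<in>K. (cmod (d k) * 1 ^ k)\<^sup>2)) (at_left 1)"
    by (intro tendsto_intros)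
  moreover have "eventually (\<lambda>r. (\<Sum>k\<in>K. (cmod (d k) * r ^ k)\<^sup>2) \<le> M\<^sup>2 * (\<Sum>k<N. (cmod (e k))\<^sup>2)) (at_left 1)"
    unfolding eventually_at_left_field by (intro exI[of _ 0]) (use r in auto)
  ultimately show ?thesis
    using tendsto_upperbound[of _ _ "at_left (1::real)"] by fastforce
qed

text \<open>Multiplication by \<open>f\<close> has norm at most \<open>M\<close> on \<open>H\<^sup>2\<close>; applied to the polynomials of degree
  less than \<open>N\<close> and read off at the coefficients from \<open>N\<close> on, it is the Hankel matrix.\<close>

lemma hankel_contraction:
  assumes a: "\<And>u. cmod u < 1 \<Longrightarrow> (\<lambda>i. a i * u ^ i) sums f u"
    and M: "\<And>u. cmod u < 1 \<Longrightarrow> cmod (f u) \<le> M"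
  shows "(\<Sum>i<I. (cmod (\<Sum>j<N. a (i + j + 1) * y j))\<^sup>2) \<le> M\<^sup>2 * (\<Sum>j<N. (cmod (y j))\<^sup>2)"
proof -
  \<comment> \<open>Reversing \<open>y\<close> turns a convolution into a Hankel sum: coefficient
    \<open>N + i\<close> of the product pairs \<open>e s\<close> with \<open>a (N + i - s)\<close>,
    and \<open>s = N - Suc j\<close> gives the index \<open>i + j + 1\<close>.\<close>
  define e where "e = (\<lambda>s. y (N - Suc s))"
  define d where "d = (\<lambda>k. \<Sum>s<N. e s * (if k < s then 0 else a (k - s)))"
  have d: "(\<lambda>k. d k * u ^ k) sums ((\<Sum>s<N. e s * u ^ s) * f u)" if "cmod u < 1" for u
  proof -
    have "(\<lambda>k. \<Sum>s<N. e s * ((if k < s then 0 else a (k - s)) * u ^ k)) sums (\<Sum>s<N. e s * (u ^ s * f u))"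
      by (intro sums_sum sums_mult sums_power_series_shift a that)
    then show ?thesis by (simp add: d_def sum_distrib_right mult.assoc)
  qed
  have "(\<Sum>k\<in>(\<lambda>i. N + i) ` {..<I}. (cmod (d k))\<^sup>2) \<le> M\<^sup>2 * (\<Sum>k<N. (cmod (e k))\<^sup>2)"
  proof (rule coeff_sum_le_of_norm_le[OF d])
    show "cmod ((\<Sum>s<N. e s * u ^ s) * f u) \<le> M * cmod (\<Sum>k<N. e k * u ^ k)" if "cmod u < 1" for u
      using mult_right_mono[OF M[OF that], of "cmod (\<Sum>k<N. e k * u ^ k)"] by (simp add: norm_mult mult.commute)
  qed auto
  moreover have "(\<Sum>k<N. (cmod (e k))\<^sup>2) = (\<Sum>j<N. (cmod (y j))\<^sup>2)"
    unfolding e_def by (rule sum.nat_diff_reindex[of "\<lambda>j. (cmod (y j))\<^sup>2"])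
  moreover have "d (N + i) = (\<Sum>j<N. a (i + j + 1) * y j)" for i
  proof -
    have "d (N + i) = (\<Sum>s<N. a (i + (N - Suc s) + 1) * y (N - Suc s))"
      unfolding d_def e_def by (intro sum.cong refl) (auto simp: Suc_diff_Suc intro!: arg_cong[of _ _ a])
    also have "\<dots> = (\<Sum>j<N. a (i + j + 1) * y j)"
      by (rule sum.nat_diff_reindex)
    finally show ?thesis .
  qed
  ultimately show ?thesis by (simp add: sum.reindex)
qed

section \<open>Rational functions and the finite rank of their Hankel matrices\<close>

lemma eventually_poly_nonzero:
  fixes Q :: "complex poly"
  assumes "Q \<noteq> 0"
  shows "eventually (\<lambda>u. poly Q u \<noteq> 0) (at z)"
  using poly_roots_finite[OF assms] islimpt_finite islimpt_iff_eventually by fastforce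

text \<open>Multiplying out the denominator gives \<open>Q * f = P\<close>; beyond the degree of
  \<open>P\<close> the coefficients of the product vanish.\<close>

lemma rational_taylor_recurrence:
  fixes P Q :: "complex poly"
  assumes a: "\<And>u. cmod u < 1 \<Longrightarrow> (\<lambda>i. a i * u ^ i) sums f u"
    and Q: "Q \<noteq> 0"
    and eq: "\<And>u. cmod u < 1 \<Longrightarrow> poly Q u \<noteq> 0 \<Longrightarrow> f u = poly P u / poly Q u"
    and n: "degree P < n"
  shows "(\<Sum>i\<le>n. coeff Q i * a (n - i)) = 0"
proof -
  define F where "F = Abs_fps a"
  have nbhd: "eventually (\<lambda>u::complex. u \<in> ball 0 1) (nhds 0)"
    by (intro eventually_nhds_in_open) auto
  have "f has_fps_expansion F"
    unfolding has_fps_expansion_def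
  proof
    have "ereal (norm (1/2 :: complex)) \<le> conv_radius a"
      by (rule conv_radius_geI) (use a[of "1/2"] in \<open>auto simp: sums_iff\<close>)
    then show "0 < fps_conv_radius F"
      unfolding fps_conv_radius_def F_def by (simp add: less_le_trans[of 0 "ereal (1/2)"])
    show "eventually (\<lambda>z. eval_fps F z = f z) (nhds 0)"
      using nbhd by eventually_elim (use a in \<open>auto simp: eval_fps_def F_def sums_iff\<close>)
  qed
  moreover have "poly R has_fps_expansion fps_of_poly R" for R :: "complex poly"
    by (simp add: has_fps_expansion_def)
  \<comment> \<open>\<open>Q\<close> may vanish at 0 and the identity is given only off its zeros.
    Laurent expansions need only a punctured neighbourhood.\<close>
  ultimately have "(\<lambda>u. poly Q u * f u) has_laurent_expansion fps_to_fls (fps_of_poly Q * F)"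
    by (intro has_laurent_expansion_fps has_fps_expansion_mult)
  moreover have "poly P has_laurent_expansion fps_to_fls (fps_of_poly P)"
    by (intro has_laurent_expansion_fps) (simp add: has_fps_expansion_def)
  moreover have "eventually (\<lambda>u. poly Q u * f u = poly P u) (at 0)"
    using eventually_poly_nonzero[OF Q, of 0] filter_leD[OF at_within_le_nhds nbhd]
    by eventually_elim (use eq in auto)
  ultimately have "fps_to_fls (fps_of_poly Q * F) = fps_to_fls (fps_of_poly P)"
    by (metis has_laurent_expansion_unique has_laurent_expansion_cong)
  then have "fps_nth (fps_of_poly Q * F) n = fps_nth (fps_of_poly P) n" by simp
  then show ?thesis
    using n by (simp add: fps_mult_nth F_def coeff_eq_0 atLeast0AtMost)
qed

text \<open>The recurrence is solved for its term with the lowest nonzero coefficient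
  \<open>q s\<close>, since \<open>q 0\<close> may be 0. This writes row \<open>i >= m\<close>
  through the earlier rows \<open>i + s - l\<close> with \<open>s < l <= m\<close>, and strong
  induction reduces these to the first \<open>m\<close> rows.\<close>

lemma hankel_rows_span:
  fixes a q :: "nat \<Rightarrow> complex"
  assumes rec: "\<And>n. m < n \<Longrightarrow> (\<Sum>i\<le>n. q i * a (n - i)) = 0"
    and deg: "\<And>i. m < i \<Longrightarrow> q i = 0" and nz: "q s0 \<noteq> 0"
  shows "\<exists>t. \<forall>j. a (i + j + 1) = (\<Sum>r<m. t r * a (r + j + 1))"
proof (induction i rule: less_induct)
  case (less i)
  define s where "s = (LEAST s. q s \<noteq> 0)"
  have s: "q s \<noteq> 0" unfolding s_def using nz by (rule LeastI)
  have s_min: "q l = 0" if "l < s" for l using that not_less_Least[of l "\<lambda>s. q s \<noteq> 0"] by (auto simp: s_def)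
  have sm: "s \<le> m" using deg[of s] s by (meson not_le)
  show ?case
  proof (cases "i < m")
    case True
    then show ?thesis
      by (intro exI[of _ "\<lambda>r. if r = i then 1 else 0"]) (simp add: if_distrib[of "\<lambda>x. x * _"] cong: if_cong)
  next
    case False
    from less.IH have "\<forall>k. \<exists>t. k < i \<longrightarrow> (\<forall>j. a (k + j + 1) = (\<Sum>r<m. t r * a (r + j + 1)))"
      by blast
    then obtain t where t: "\<And>k j. k < i \<Longrightarrow> a (k + j + 1) = (\<Sum>r<m. t k r * a (r + j + 1))"
      by metis
    have row: "a (i + j + 1) = (\<Sum>l\<in>{s<..m}. - (q l / q s) * a ((i + s - l) + j + 1))" for j
    proof -
      \<comment> \<open>Chosen so that \<open>n - s = i + j + 1\<close>; it exceeds \<open>m\<close>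
        because \<open>i >= m\<close>.\<close>
      define n where "n = i + j + 1 + s"
      have "0 = (\<Sum>l\<le>n. q l * a (n - l))" using rec[of n] False by (simp add: n_def)
      also have "\<dots> = (\<Sum>l\<in>{s..m}. q l * a (n - l))"
        by (rule sum.mono_neutral_right) (use False deg s_min in \<open>auto simp: n_def not_le intro: ccontr\<close>)
      also have "\<dots> = q s * a (n - s) + (\<Sum>l\<in>{s<..m}. q l * a (n - l))"
        using sm by (simp add: sum.head)
      also have "(\<Sum>l\<in>{s<..m}. q l * a (n - l)) = (\<Sum>l\<in>{s<..m}. q l * a ((i + s - l) + j + 1))"
        using False by (intro sum.cong refl arg_cong2[of _ _ _ _ "(*)"] arg_cong[of _ _ a]) (auto simp: n_def)
      finally have "a (i + j + 1) = - (\<Sum>l\<in>{s<..m}. q l * a ((i + s - l) + j + 1)) / q s"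
        using s by (simp add: n_def field_simps add_eq_0_iff)
      also have "\<dots> = (\<Sum>l\<in>{s<..m}. - (q l / q s) * a ((i + s - l) + j + 1))"
        by (simp add: sum_negf sum_divide_distrib)
      finally show ?thesis .
    qed
    show ?thesis
    proof (intro exI[of _ "\<lambda>r. \<Sum>l\<in>{s<..m}. - (q l / q s) * t (i + s - l) r"] allI)
      fix j
      have "a (i + j + 1) = (\<Sum>l\<in>{s<..m}. - (q l / q s) * (\<Sum>r<m. t (i + s - l) r * a (r + j + 1)))"
        unfolding row by (intro sum.cong refl, subst t) (use False in auto)
      also have "\<dots> = (\<Sum>r<m. (\<Sum>l\<in>{s<..m}. - (q l / q s) * t (i + s - l) r) * a (r + j + 1))"
        unfolding sum_distrib_left sum_distrib_right by (subst sum.swap) (simp add: mult_ac)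
      finally show "a (i + j + 1) = (\<Sum>r<m. (\<Sum>l\<in>{s<..m}. - (q l / q s) * t (i + s - l) r) * a (r + j + 1))" .
    qed
  qed
qed

lemma rational_dirichlet_bound:
  fixes P Q :: "complex poly"
  assumes a: "\<And>u. cmod u < 1 \<Longrightarrow> (\<lambda>i. a i * u ^ i) sums f u"
    and M: "\<And>u. cmod u < 1 \<Longrightarrow> cmod (f u) \<le> M"
    and Q: "Q \<noteq> 0"
    and eq: "\<And>u. cmod u < 1 \<Longrightarrow> poly Q u \<noteq> 0 \<Longrightarrow> f u = poly P u / poly Q u"
    and deg: "degree P \<le> m" "degree Q \<le> m"
  shows "(\<Sum>k\<le>K. k * (cmod (a k))\<^sup>2) \<le> m * M\<^sup>2"
proof -
  have "\<forall>i. \<exists>t. \<forall>j. a (i + j + 1) = (\<Sum>r<m. t r * a (r + j + 1))"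
  proof (intro allI hankel_rows_span[where q="coeff Q" and ?s0.0="degree Q"])
    show "(\<Sum>i\<le>n. coeff Q i * a (n - i)) = 0" if "m < n" for n
      by (rule rational_taylor_recurrence[OF a Q eq]) (use that deg in auto)
  qed (use Q deg in \<open>auto intro: coeff_eq_0\<close>)
  then obtain t where t: "\<And>i j. a (i + j + 1) = (\<Sum>r<m. t i r * a (r + j + 1))" by metis
  have HS: "(\<Sum>i<K. \<Sum>j<K. (cmod (a (i + j + 1)))\<^sup>2) \<le> m * M\<^sup>2"
    by (rule hilbert_schmidt_le_rank[where t=t, OF _ t hankel_contraction[OF a M]]) auto
  \<comment> \<open>The factor \<open>k\<close> counts the pairs \<open>(i, j)\<close> with
    \<open>i + j + 1 = k\<close>; for \<open>k <= K\<close> they all lie in the \<open>K\<close> by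
    \<open>K\<close> corner of the Hankel matrix.\<close>
  have "(\<Sum>k\<le>K. k * (cmod (a k))\<^sup>2) = (\<Sum>(k, i)\<in>(SIGMA k:{..K}. {..<k}). (cmod (a k))\<^sup>2)"
    by (subst sum.Sigma[symmetric]) auto
  also have "\<dots> = (\<Sum>(i, j)\<in>(\<lambda>(k, i). (i, k - 1 - i)) ` (SIGMA k:{..K}. {..<k}). (cmod (a (i + j + 1)))\<^sup>2)"
    by (subst sum.reindex) (auto simp: inj_on_def intro!: sum.cong)
  also have "\<dots> \<le> (\<Sum>(i, j)\<in>{..<K} \<times> {..<K}. (cmod (a (i + j + 1)))\<^sup>2)"
    by (intro sum_mono2) auto
  also have "\<dots> \<le> m * M\<^sup>2" using HS by (simp add: sum.cartesian_product)
  finally show ?thesis .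
qed

section \<open>Slices of bounded rational functions\<close>

lemma multi_power_mult:
  "multi_power (\<chi> j. x $ j * y $ j) k = multi_power x k * multi_power y k"
  by (simp add: multi_power_def power_mult_distrib prod.distrib)

lemma multi_power_scale_coord:
  "multi_power (vec_upd z j (u * z $ j)) k = u ^ (k $ j) * multi_power z k"
proof -
  have "multi_power (vec_upd z j w) k = w ^ (k $ j) * (\<Prod>l\<in>UNIV - {j}. z $ l ^ (k $ l))" for w
    unfolding multi_power_def by (subst prod.remove[of _ j]) auto
  from this[of "u * z $ j"] this[of "z $ j"] show ?thesis
    by (simp add: power_mult_distrib mult_ac)
qed

lemma continuous_multi_power [continuous_intros]:
  "continuous_on A (\<lambda>z. multi_power z k)"
  unfolding multi_power_def by (intro continuous_intros)

lemma const_in_polydisc: "\<bar>r\<bar> < 1 \<Longrightarrow> (\<chi> j. complex_of_real r) \<in> polydisc"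
  by (simp add: polydisc_def)

text \<open>Weierstrass test on a smaller polydisc around \<open>z\<close>, whose radius
  \<open>r\<close> lies strictly between the largest \<open>cmod (z $ j)\<close> and 1; the majorant
  is the series at the constant point \<open>r\<close>.\<close>

lemma continuous_power_series:
  fixes c :: "nat ^ 'n \<Rightarrow> complex"
  assumes c: "\<And>k. cmod (c k) \<le> M"
  shows "continuous_on polydisc (\<lambda>z. \<Sum>\<^sub>\<infinity>k. c k * multi_power z k)"
proof (rule continuous_at_imp_continuous_on, rule ballI)
  fix z :: "complex ^ 'n" assume "z \<in> polydisc"
  then have z: "cmod (z $ j) < 1" for j by (auto simp: polydisc_def)
  define m where "m = Max (range (\<lambda>j. cmod (z $ j)))"
  have "m < 1" unfolding m_def by (subst Max_less_iff) (use z in auto)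
  then obtain r where r: "m < r" "r < 1" using dense by blast
  have zm: "cmod (z $ j) \<le> m" for j unfolding m_def by (rule Max_ge) auto
  have r0: "0 < r" using zm[of undefined] r(1) norm_ge_zero[of "z $ undefined"] by linarith
  define U where "U = {y :: complex ^ 'n. \<forall>j. cmod (y $ j) < r}"
  have "U = (\<Inter>j. {y. cmod (y $ j) < r})" by (auto simp: U_def)
  then have U: "open U"
    by (simp only:) (intro open_INT ballI open_Collect_less continuous_intros, auto)
  have zU: "z \<in> U" using zm r by (auto simp: U_def intro: le_less_trans)
  have M: "0 \<le> M" using c[of undefined] norm_ge_zero order_trans by blast
  have "uniform_limit U (\<lambda>X y. \<Sum>k\<in>X. c k * multi_power y k) (\<lambda>y. \<Sum>\<^sub>\<infinity>k. c k * multi_power y k)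
          (finite_subsets_at_top UNIV)"
  proof (rule Weierstrass_m_test_general)
    show "cmod (c k * multi_power y k) \<le> M * cmod (multi_power (\<chi> j. complex_of_real r) k)" if "y \<in> U" for k y
      unfolding norm_mult norm_multi_power
      using that r0 by (intro mult_mono c prod_mono prod_nonneg M) (auto simp: U_def intro!: power_mono intro: less_imp_le)
    show "(\<lambda>k. M * cmod (multi_power (\<chi> j. complex_of_real r) k)) summable_on (UNIV :: (nat ^ 'n) set)"
      by (intro summable_on_cmult_right norm_multi_power_summable const_in_polydisc) (use r r0 in auto)
  qed
  then have "continuous_on U (\<lambda>y. \<Sum>\<^sub>\<infinity>k. c k * multi_power y k)"
    by (rule uniform_limit_theorem[rotated]) (auto intro!: always_eventually continuous_intros)
  then show "isCont (\<lambda>y. \<Sum>\<^sub>\<infinity>k. c k * multi_power y k) z"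
    using U zU by (simp add: continuous_on_eq_continuous_at)
qed

text \<open>The hypothesis is averaged over the torus of radius \<open>r\<close>, Parseval is
  applied for each \<open>i\<close>, and \<open>r\<close> tends to 1. It serves for the slice
  coefficients and, with a one-point index set, for single power series.\<close>

lemma weighted_parseval_le:
  fixes b :: "'i \<Rightarrow> nat ^ 'n \<Rightarrow> complex"
  assumes I: "finite I" and K: "finite K" and wt: "\<And>i. 0 \<le> wt i"
    and b: "\<And>i k. cmod (b i k) \<le> M"
    and C: "\<And>z. z \<in> polydisc \<Longrightarrow> (\<Sum>i\<in>I. wt i * (cmod (\<Sum>\<^sub>\<infinity>k. b i k * multi_power z k))\<^sup>2) \<le> C"
  shows "(\<Sum>i\<in>I. wt i * (\<Sum>k\<in>K. (cmod (b i k))\<^sup>2)) \<le> C"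
proof -
  let ?\<rho> = "\<lambda>r. \<chi> j :: 'n. complex_of_real r"
  have r: "(\<Sum>i\<in>I. wt i * (\<Sum>k\<in>K. (cmod (b i k * multi_power (?\<rho> r) k))\<^sup>2)) \<le> C" if r: "0 < r" "r < 1" for r
  proof -
    have \<rho>: "?\<rho> r \<in> polydisc" using r by (intro const_in_polydisc) auto
    define d where "d = (\<lambda>i k. b i k * multi_power (?\<rho> r) k)"
    have d: "(\<lambda>k. cmod (d i k)) summable_on UNIV" for i
      unfolding d_def by (rule power_series_abs_summable[OF b \<rho>])
    define T where "T = (\<lambda>N. (UNIV :: 'n set) \<rightarrow>\<^sub>E {..<N::nat})"
    define S where "S = (\<lambda>i N x. \<Sum>\<^sub>\<infinity>k. d i k * multi_power (unity_grid N x) k)"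
    have lim: "(\<lambda>N. \<Sum>i\<in>I. wt i * ((\<Sum>x\<in>T N. (cmod (S i N x))\<^sup>2) / card (T N)))
        \<longlonglongrightarrow> (\<Sum>i\<in>I. wt i * (\<Sum>\<^sub>\<infinity>k. (cmod (d i k))\<^sup>2))"
      unfolding S_def T_def by (intro tendsto_intros parseval_multi d)
    have le: "(\<Sum>i\<in>I. wt i * ((\<Sum>x\<in>T N. (cmod (S i N x))\<^sup>2) / card (T N))) \<le> C" if N: "N > 0" for N
    proof -
      have card: "card (T N) > 0" using N by (simp add: T_def card_PiE)
      have "(\<Sum>i\<in>I. wt i * (cmod (S i N x))\<^sup>2) \<le> C" for x
      proof -
        let ?z = "\<chi> j. ?\<rho> r $ j * unity_grid N x $ j"
        have "?z \<in> polydisc"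
          using r by (simp add: polydisc_def unity_grid_def norm_mult)
        moreover have "(\<Sum>\<^sub>\<infinity>k. b i k * multi_power ?z k) = S i N x" for i
          unfolding S_def d_def multi_power_mult by (simp add: mult.assoc)
        ultimately show ?thesis using C[of ?z] by simp
      qed
      then have "(\<Sum>x\<in>T N. \<Sum>i\<in>I. wt i * (cmod (S i N x))\<^sup>2) \<le> card (T N) * C"
        using sum_bounded_above[of "T N" _ C] by simp
      then have "(\<Sum>x\<in>T N. \<Sum>i\<in>I. wt i * (cmod (S i N x))\<^sup>2) / card (T N) \<le> C"
        using card by (simp add: field_simps)
      also have "(\<Sum>x\<in>T N. \<Sum>i\<in>I. wt i * (cmod (S i N x))\<^sup>2) / card (T N)
         = (\<Sum>i\<in>I. wt i * ((\<Sum>x\<in>T N. (cmod (S i N x))\<^sup>2) / card (T N)))"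
        by (subst sum.swap) (simp add: sum_divide_distrib sum_distrib_left)
      finally show ?thesis .
    qed
    have "(\<Sum>i\<in>I. wt i * (\<Sum>k\<in>K. (cmod (d i k))\<^sup>2)) \<le> (\<Sum>i\<in>I. wt i * (\<Sum>\<^sub>\<infinity>k. (cmod (d i k))\<^sup>2))"
    proof (intro sum_mono mult_left_mono wt finite_sum_le_infsum K)
      fix i
      have bd: "cmod (d i k) \<le> (\<Sum>\<^sub>\<infinity>k. cmod (d i k))" for k
        using finite_sum_le_infsum[OF d, of "{k}"] by simp
      show "(\<lambda>k. (cmod (d i k))\<^sup>2) summable_on UNIV"
        by (rule summable_on_comparison_test[OF summable_on_cmult_right[OF d]])
           (auto simp: power2_eq_square intro!: mult_right_mono bd)
    qed auto
    also have "\<dots> \<le> C"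
      by (rule LIMSEQ_le_const2[OF lim]) (use le in \<open>auto intro!: exI[of _ 1]\<close>)
    finally show ?thesis by (simp add: d_def)
  qed
  have "((\<lambda>r. \<Sum>i\<in>I. wt i * (\<Sum>k\<in>K. (cmod (b i k * multi_power (?\<rho> r) k))\<^sup>2)) \<longlongrightarrow>
      (\<Sum>i\<in>I. wt i * (\<Sum>k\<in>K. (cmod (b i k * multi_power (?\<rho> 1) k))\<^sup>2))) (at_left 1)"
    unfolding multi_power_def vec_lambda_beta by (intro tendsto_intros)
  moreover have "eventually (\<lambda>r. (\<Sum>i\<in>I. wt i * (\<Sum>k\<in>K. (cmod (b i k * multi_power (?\<rho> r) k))\<^sup>2)) \<le> C) (at_left 1)"
    unfolding eventually_at_left_field by (intro exI[of _ 0]) (use r in auto)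
  ultimately have "(\<Sum>i\<in>I. wt i * (\<Sum>k\<in>K. (cmod (b i k * multi_power (?\<rho> 1) k))\<^sup>2)) \<le> C"
    by (rule tendsto_upperbound) auto
  then show ?thesis by (simp add: multi_power_def)
qed

text \<open>A polynomial vanishing on the whole polydisc satisfies the Parseval bound with
  \<open>C = 0\<close>, so all its coefficients are 0.\<close>

lemma mpoly_nonvanishing:
  fixes q :: "(nat ^ 'n) \<Rightarrow>\<^sub>0 complex"
  assumes "q \<noteq> 0"
  obtains v where "v \<in> polydisc" "mpoly_eval q v \<noteq> 0"
proof (rule ccontr)
  assume "\<not> thesis"
  with that have 0: "mpoly_eval q v = 0" if "v \<in> polydisc" for v using that by blast
  define b where "b = (\<lambda>_ :: unit. Poly_Mapping.lookup q)"
  have eval: "(\<Sum>\<^sub>\<infinity>k. b i k * multi_power z k) = mpoly_eval q z" for i z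
    unfolding mpoly_eval_def
    by (subst infsum_cong_neutral[where T="Poly_Mapping.keys q"
          and g="\<lambda>k. Poly_Mapping.lookup q k * multi_power z k"])
       (auto simp: b_def in_keys_iff)
  have "cmod (b i k) \<le> (\<Sum>k\<in>Poly_Mapping.keys q. cmod (Poly_Mapping.lookup q k))" for i k
    by (cases "k \<in> Poly_Mapping.keys q")
       (auto simp: b_def in_keys_iff sum_nonneg intro!: member_le_sum)
  from weighted_parseval_le[where I="{()}" and b=b and wt="\<lambda>_. 1" and C=0, OF _ finite_keys[of q] _ this]
  have "(\<Sum>k\<in>Poly_Mapping.keys q. (cmod (Poly_Mapping.lookup q k))\<^sup>2) \<le> 0"
    by (simp add: eval 0) (simp add: b_def)
  then have "(\<Sum>k\<in>Poly_Mapping.keys q. (cmod (Poly_Mapping.lookup q k))\<^sup>2) = 0"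
    by (intro order_antisym sum_nonneg) auto
  then have "\<forall>k\<in>Poly_Mapping.keys q. Poly_Mapping.lookup q k = 0"
    by (simp add: sum_nonneg_eq_0_iff)
  then have "q = 0" by (intro poly_mapping_eqI) (auto simp: in_keys_iff)
  with assms show False by simp
qed

text \<open>Coordinate \<open>j\<close> is multiplied by the new variable, not replaced by it. The
  coefficients then retain the full monomials in \<open>z\<close>, so that Parseval in all variables
  can be applied to them.\<close>

definition slice_poly :: "((nat ^ 'n) \<Rightarrow>\<^sub>0 complex) \<Rightarrow> 'n \<Rightarrow> complex ^ 'n \<Rightarrow> complex poly" where
  "slice_poly p j z = (\<Sum>k\<in>Poly_Mapping.keys p. monom (Poly_Mapping.lookup p k * multi_power z k) (k $ j))"

lemma poly_slice_poly: "poly (slice_poly p j z) u = mpoly_eval p (vec_upd z j (u * z $ j))"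
  by (simp add: slice_poly_def mpoly_eval_def poly_sum poly_monom multi_power_scale_coord mult_ac)

lemma degree_slice_poly_le:
  assumes "\<And>k. k \<in> Poly_Mapping.keys p \<Longrightarrow> k $ j \<le> m"
  shows "degree (slice_poly p j z) \<le> m"
  unfolding slice_poly_def
  by (intro degree_sum_le order_trans[OF degree_monom_le] assms) auto

lemma slice_poly_nonzero:
  assumes "mpoly_eval p z \<noteq> 0"
  shows "slice_poly p j z \<noteq> 0"
  using assms poly_slice_poly[of p j z 1] by auto

text \<open>The coefficient of \<open>u ^ i\<close> in the slice, padded with zeros to a power
  series over all multi-indices as \<open>weighted_parseval_le\<close> expects.\<close>

definition slice_coeff :: "(nat ^ 'n \<Rightarrow> complex) \<Rightarrow> 'n \<Rightarrow> nat \<Rightarrow> complex ^ 'n \<Rightarrow> complex" where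
  "slice_coeff c j i z = (\<Sum>\<^sub>\<infinity>k. (if k $ j = i then c k else 0) * multi_power z k)"

lemma slice_coeff_sums:
  fixes \<phi> :: "complex ^ 'n \<Rightarrow> complex"
  assumes c: "\<And>k. cmod (c k) \<le> M"
    and \<phi>: "\<And>z. z \<in> polydisc \<Longrightarrow> ((\<lambda>k. c k * multi_power z k) has_sum \<phi> z) UNIV"
    and z: "z \<in> polydisc" and y: "vec_upd z j (u * z $ j) \<in> polydisc"
  shows "(\<lambda>i. slice_coeff c j i z * u ^ i) sums \<phi> (vec_upd z j (u * z $ j))"
proof -
  let ?t = "\<lambda>k. c k * multi_power (vec_upd z j (u * z $ j)) k"
  have "((\<lambda>(i, k). ?t k) has_sum \<phi> (vec_upd z j (u * z $ j))) (Sigma UNIV (\<lambda>i. {k. k $ j = i}))"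
    by (rule has_sum_reindex_bij_witness[of _ "\<lambda>k. (k $ j, k)" snd, THEN iffD2, OF _ _ _ _ _ refl \<phi>[OF y]]) auto
  then have "((\<lambda>i. slice_coeff c j i z * u ^ i) has_sum \<phi> (vec_upd z j (u * z $ j))) UNIV"
  proof (rule has_sum_SigmaD)
    fix i
    have "((\<lambda>k. c k * multi_power z k) has_sum slice_coeff c j i z) {k. k $ j = i}"
    proof -
      have "slice_coeff c j i z = (\<Sum>\<^sub>\<infinity>k\<in>{k. k $ j = i}. c k * multi_power z k)"
        unfolding slice_coeff_def by (rule infsum_cong_neutral) auto
      then show ?thesis
        using abs_summable_summable[OF power_series_abs_summable[OF c z]] by (auto intro: has_sum_infsum)
    qed
    then have "((\<lambda>k. c k * multi_power z k * u ^ i) has_sum (slice_coeff c j i z * u ^ i)) {k. k $ j = i}"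
      by (rule has_sum_cmult_left)
    then show "((\<lambda>y. case (i, y) of (i, k) \<Rightarrow> ?t k) has_sum (slice_coeff c j i z * u ^ i)) {k. k $ j = i}"
      by (rule has_sum_cong[THEN iffD1, rotated]) (auto simp: multi_power_scale_coord mult_ac)
  qed
  then show ?thesis by (rule has_sum_imp_sums)
qed

text \<open>On the complex line joining \<open>z\<close> to a point where \<open>q\<close> does not
  vanish, \<open>q\<close> is a nonzero polynomial in \<open>t\<close>. Hence \<open>z\<close> is a
  limit of points where the bound holds, and \<open>F\<close> is continuous.\<close>

lemma dense_mpoly_nonzero_bound:
  fixes F :: "complex ^ 'n \<Rightarrow> real"
  assumes q: "q \<noteq> 0" and F: "continuous_on polydisc F"
    and le: "\<And>z. z \<in> polydisc \<Longrightarrow> mpoly_eval q z \<noteq> 0 \<Longrightarrow> F z \<le> C"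
    and z: "z \<in> polydisc"
  shows "F z \<le> C"
proof -
  obtain v where v: "mpoly_eval q v \<noteq> 0" using mpoly_nonvanishing[OF q] by metis
  define \<gamma> where "\<gamma> = (\<lambda>t. \<chi> j. z $ j + t * (v $ j - z $ j))"
  define R where "R = (\<Sum>k\<in>Poly_Mapping.keys q. smult (Poly_Mapping.lookup q k)
      (\<Prod>j\<in>UNIV. [:z $ j, v $ j - z $ j:] ^ (k $ j)))"
  have R: "poly R t = mpoly_eval q (\<gamma> t)" for t
    by (simp add: R_def \<gamma>_def mpoly_eval_def multi_power_def poly_sum poly_prod)
  have "\<gamma> 1 = v" by (simp add: \<gamma>_def vec_eq_iff)
  with v R[of 1] have "R \<noteq> 0" by auto
  then have ev: "eventually (\<lambda>t. mpoly_eval q (\<gamma> t) \<noteq> 0) (at 0)"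
    using eventually_poly_nonzero[of R 0] by (simp add: R)
  have "(\<gamma> \<longlongrightarrow> (\<chi> j. z $ j + 0 * (v $ j - z $ j))) (at 0)"
    unfolding \<gamma>_def by (intro tendsto_intros)
  then have \<gamma>: "(\<gamma> \<longlongrightarrow> z) (at 0)" by simp
  have "eventually (\<lambda>t. \<gamma> t \<in> polydisc) (at 0)"
    by (rule topological_tendstoD[OF \<gamma> open_polydisc z])
  with ev have "eventually (\<lambda>t. F (\<gamma> t) \<le> C) (at 0)"
    by eventually_elim (rule le)
  moreover have "isCont F z"
    using F z continuous_on_eq_continuous_at[OF open_polydisc] by blast
  then have "((\<lambda>t. F (\<gamma> t)) \<longlongrightarrow> F z) (at 0)"
    using \<gamma> by (rule isCont_tendsto_compose)
  ultimately show ?thesis by (intro tendsto_upperbound[of _ _ "at (0::complex)"]) auto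
qed

text \<open>\<open>m\<close> bounds the degrees of \<open>p\<close> and \<open>q\<close> in variable
  \<open>j\<close>, so the one-variable bound is uniform in \<open>z\<close>. It holds first where
  \<open>q\<close> is nonzero, extends by density, and is then averaged over tori.\<close>

lemma bounded_rational_weighted_sum_le:
  fixes \<phi> :: "complex ^ 'n \<Rightarrow> complex"
  assumes c: "\<And>k. cmod (c k) \<le> M"
    and \<phi>: "\<And>z. z \<in> polydisc \<Longrightarrow> ((\<lambda>k. c k * multi_power z k) has_sum \<phi> z) UNIV"
    and M: "\<And>z. z \<in> polydisc \<Longrightarrow> cmod (\<phi> z) \<le> M"
    and q: "q \<noteq> 0"
    and eq: "\<And>z. z \<in> polydisc \<Longrightarrow> mpoly_eval q z \<noteq> 0 \<Longrightarrow> \<phi> z = mpoly_eval p z / mpoly_eval q z"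
  obtains m where "\<And>K. finite K \<Longrightarrow> (\<Sum>k\<in>K. k $ j * (cmod (c k))\<^sup>2) \<le> m * M\<^sup>2"
proof -
  define m where "m = Max ((\<lambda>k. k $ j) ` (insert 0 (Poly_Mapping.keys p \<union> Poly_Mapping.keys q)))"
  have m: "k $ j \<le> m" if "k \<in> Poly_Mapping.keys p \<union> Poly_Mapping.keys q" for k
    unfolding m_def by (rule Max_ge) (use that in auto)
  have good: "(\<Sum>i\<le>N. i * (cmod (slice_coeff c j i z))\<^sup>2) \<le> m * M\<^sup>2"
    if z: "z \<in> polydisc" and qz: "mpoly_eval q z \<noteq> 0" for z N
  proof (rule rational_dirichlet_bound[where f="\<lambda>u. \<phi> (vec_upd z j (u * z $ j))"
        and P="slice_poly p j z" and Q="slice_poly q j z"])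
    have y: "vec_upd z j (u * z $ j) \<in> polydisc" if "cmod u < 1" for u
    proof (rule vec_upd_in_polydisc[OF z])
      have "cmod (z $ j) < 1" using z by (auto simp: polydisc_def)
      then show "cmod (u * z $ j) < 1"
        using that mult_le_one[of "cmod u" "cmod (z $ j)"] mult_less_cancel_right2[of "cmod u" "cmod (z $ j)"]
        by (cases "z $ j = 0") (auto simp: norm_mult intro: le_less_trans[OF mult_left_le_one_le])
    qed
    show "(\<lambda>i. slice_coeff c j i z * u ^ i) sums \<phi> (vec_upd z j (u * z $ j))" if "cmod u < 1" for u
      by (rule slice_coeff_sums[OF c \<phi> z y[OF that]])
    show "cmod (\<phi> (vec_upd z j (u * z $ j))) \<le> M" if "cmod u < 1" for u
      using M y[OF that] .
    show "\<phi> (vec_upd z j (u * z $ j)) = poly (slice_poly p j z) u / poly (slice_poly q j z) u"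
      if "cmod u < 1" "poly (slice_poly q j z) u \<noteq> 0" for u
      using eq[OF y] that by (simp add: poly_slice_poly)
  qed (use m qz in \<open>auto intro!: degree_slice_poly_le slice_poly_nonzero\<close>)
  have b: "cmod (if k $ j = i then c k else 0) \<le> M" for i k
    using c[of k] order_trans[OF norm_ge_zero c[of k]] by auto
  have all: "(\<Sum>i\<le>N. i * (cmod (slice_coeff c j i z))\<^sup>2) \<le> m * M\<^sup>2" if z: "z \<in> polydisc" for z N
    by (rule dense_mpoly_nonzero_bound[OF q _ good z])
       (unfold slice_coeff_def, intro continuous_intros continuous_power_series[OF b])
  show ?thesis
  proof (rule that[of m])
    fix K :: "(nat ^ 'n) set" assume K: "finite K"
    \<comment> \<open>Large enough that each \<open>k\<close> in \<open>K\<close> is met by exactly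
      one \<open>i <= N\<close>, namely \<open>i = k $ j\<close>.\<close>
    define N where "N = Max ((\<lambda>k. k $ j) ` insert 0 K)"
    have N: "k $ j \<le> N" if "k \<in> K" for k unfolding N_def by (rule Max_ge) (use that K in auto)
    have "(\<Sum>i\<le>N. real i * (\<Sum>k\<in>K. (cmod (if k $ j = i then c k else 0))\<^sup>2)) \<le> m * M\<^sup>2"
      by (rule weighted_parseval_le[OF _ K _ b]) (use all in \<open>auto simp: slice_coeff_def\<close>)
    also have "(\<Sum>i\<le>N. real i * (\<Sum>k\<in>K. (cmod (if k $ j = i then c k else 0))\<^sup>2))
        = (\<Sum>k\<in>K. \<Sum>i\<le>N. if k $ j = i then k $ j * (cmod (c k))\<^sup>2 else 0)"
      unfolding sum_distrib_left by (subst sum.swap) (intro sum.cong refl, auto)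
    also have "\<dots> = (\<Sum>k\<in>K. k $ j * (cmod (c k))\<^sup>2)"
      using N by (intro sum.cong refl) auto
    finally show "(\<Sum>k\<in>K. k $ j * (cmod (c k))\<^sup>2) \<le> m * M\<^sup>2" .
  qed
qed

section \<open>From the coordinate weights to the weight of the Dirichlet space\<close>

lemma prod_powr_le_sum:
  fixes x :: "'n::finite \<Rightarrow> real"
  assumes "\<And>j. 0 < x j"
  shows "(\<Prod>j\<in>UNIV. x j powr (1 / real CARD('n))) \<le> (\<Sum>j\<in>UNIV. x j)"
proof -
  have pos: "0 < (\<Sum>j\<in>UNIV. x j)" by (intro sum_pos assms) auto
  \<comment> \<open>Each \<open>x j\<close> is at most the total, and the \<open>CARD('n)\<close>
    equal factors multiply back to the total.\<close>
  have "(\<Prod>j\<in>UNIV. x j powr (1 / real CARD('n))) \<le> (\<Prod>j\<in>(UNIV :: 'n set). (\<Sum>j\<in>UNIV. x j) powr (1 / real CARD('n)))"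
    using assms by (intro prod_mono conjI powr_mono2 member_le_sum) (auto intro: less_imp_le)
  also have "\<dots> = (\<Sum>j\<in>UNIV. x j)"
    using pos by (simp add: powr_powr flip: powr_realpow)
  finally show ?thesis .
qed

theorem corollary2:
  fixes \<phi> :: "complex ^ 'n \<Rightarrow> complex"
  assumes "rational_inner \<phi>"
  shows "\<phi> \<in> dirichlet_space (\<chi> j. 1 / real CARD('n))"
proof -
  from assms have hol: "multi_holomorphic_on \<phi> polydisc" and bd: "bounded (\<phi> ` polydisc)"
    by (auto simp: rational_inner_def)
  from assms obtain p q where q: "q \<noteq> 0"
    and eq: "\<And>z. z \<in> polydisc \<Longrightarrow> mpoly_eval q z \<noteq> 0 \<Longrightarrow> \<phi> z = mpoly_eval p z / mpoly_eval q z"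
    unfolding rational_inner_def by metis
  from bd obtain M where M: "\<And>z. z \<in> polydisc \<Longrightarrow> cmod (\<phi> z) \<le> M"
    by (auto simp: bounded_iff)
  obtain c where c: "\<And>k. cmod (c k) \<le> M"
    and \<phi>: "\<And>z. z \<in> polydisc \<Longrightarrow> ((\<lambda>k. c k * multi_power z k) has_sum \<phi> z) UNIV"
    using sep_holomorphic_expansion[OF multi_holomorphic_imp_sep_holomorphic[OF hol M]] by metis
  have "\<exists>m. \<forall>K. finite K \<longrightarrow> (\<Sum>k\<in>K. real (k $ j) * (cmod (c k))\<^sup>2) \<le> m * M\<^sup>2" for j
    using bounded_rational_weighted_sum_le[OF c \<phi> M q eq, of j] by metis
  then obtain m where m: "\<And>j K. finite K \<Longrightarrow> (\<Sum>k\<in>K. real (k $ j) * (cmod (c k))\<^sup>2) \<le> m j * M\<^sup>2"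
    by metis
  \<comment> \<open>Unweighted Parseval bound, needed for the summand 1 in each weight
    \<open>1 + k $ j\<close>.\<close>
  have l2: "(\<Sum>k\<in>K. (cmod (c k))\<^sup>2) \<le> M\<^sup>2" if "finite K" for K
  proof -
    have "(\<Sum>i\<in>{()}. 1 * (\<Sum>k\<in>K. (cmod (c k))\<^sup>2)) \<le> M\<^sup>2"
      by (rule weighted_parseval_le[OF _ that _ c]) (use infsumI[OF \<phi>] M in \<open>auto intro: power_mono\<close>)
    then show ?thesis by simp
  qed
  have "(\<lambda>k. (\<Prod>j\<in>UNIV. (1 + real (k $ j)) powr (1 / real CARD('n))) * (cmod (c k))\<^sup>2) summable_on UNIV"
  proof (rule nonneg_bdd_above_summable_on)
    show "bdd_above (sum (\<lambda>k. (\<Prod>j\<in>UNIV. (1 + real (k $ j)) powr (1 / real CARD('n))) * (cmod (c k))\<^sup>2)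
        ` {F. F \<subseteq> UNIV \<and> finite F})"
    proof (rule bdd_aboveI2)
      fix K :: "(nat ^ 'n) set" assume "K \<in> {F. F \<subseteq> UNIV \<and> finite F}"
      then have K: "finite K" by simp
      have "(\<Sum>k\<in>K. (\<Prod>j\<in>UNIV. (1 + real (k $ j)) powr (1 / real CARD('n))) * (cmod (c k))\<^sup>2)
          \<le> (\<Sum>k\<in>K. (\<Sum>j\<in>UNIV. 1 + real (k $ j)) * (cmod (c k))\<^sup>2)"
        by (intro sum_mono mult_right_mono prod_powr_le_sum) auto
      also have "\<dots> = (\<Sum>j\<in>UNIV. (\<Sum>k\<in>K. (cmod (c k))\<^sup>2) + (\<Sum>k\<in>K. real (k $ j) * (cmod (c k))\<^sup>2))"
        unfolding sum_distrib_right by (subst sum.swap) (simp add: distrib_right sum.distrib)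
      also have "\<dots> \<le> (\<Sum>j\<in>UNIV. M\<^sup>2 + m j * M\<^sup>2)"
        by (intro sum_mono add_mono l2 m K)
      finally show "(\<Sum>k\<in>K. (\<Prod>j\<in>UNIV. (1 + real (k $ j)) powr (1 / real CARD('n))) * (cmod (c k))\<^sup>2)
          \<le> (\<Sum>j\<in>UNIV. M\<^sup>2 + m j * M\<^sup>2)" .
    qed
  qed (auto intro!: mult_nonneg_nonneg prod_nonneg)
  then show ?thesis
    unfolding dirichlet_space_def using hol \<phi> by auto
qed

end
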